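(* Let $n\ge2$, $1\le p<\infty$, and for $j=1,\dots,n$ let $p\le\theta_j\le\infty$ and $0<\beta_j<1$. Set $$\beta=n\left(\sum_{j=1}^n\frac1{\beta_j}\right)^{-1},\qquad \theta=\frac{n}{\beta}\left(\sum_{j=1}^n\frac{1}{\beta_j\theta_j}\right)^{-1}.$$ Assume $1\le p<n/\beta$ and let $q=np/(n-\beta p)$. Then there exists a constant $c>0$ such that for every function $f\in\bigcap_{j=1}^n B^{\beta_j}_{p,\theta_j;j}(\mathbb{R}^n)$, $$\|f\|_{q,\theta}\le c\prod_{j=1}^n\left[(1-\beta_j)^{1/\theta_j}\|f\|_{b^{\beta_j}_{p,\theta_j;j}}\right]^{\beta/(n\beta_j)}$$ (with the conventions $1/\infty=0$).
   Context: For a measurable $f$ on $\mathbb{R}^n$ with finite distribution function, $f^*$ denotes its nonincreasing left-continuous rearrangement on $(0,\infty)$ (equimeasurable with $|f|$). Lorentz (quasi)norm: for $0<q<\infty$, $0<\theta<\infty$, $\|f\|_{q,\theta}=\left(\int_0^\infty (t^{1/q}f^*(t))^\theta\,\frac{dt}{t}\right)^{1/\theta}$, and $\|f\|_{q,\infty}=\sup_{t>0}t^{1/q}f^*(t)$. Partial modulus of continuity: $\omega_k(f;\delta)_p=\sup_{|h|\le\delta}\left(\int_{\mathbb{R}^n}|f(x+he_k)-f(x)|^pdx\right)^{1/p}$, $e_k$ the $k$-th unit coordinate vector. For $0<\alpha<1$, $1\le\theta<\infty$: $\|f\|_{b^\alpha_{p,\theta;k}}=\left(\int_0^\infty(t^{-\alpha}\omega_k(f;t)_p)^\theta\frac{dt}{t}\right)^{1/\theta}$,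 and $\|f\|_{b^\alpha_{p,\infty;k}}=\sup_{\delta>0}\delta^{-\alpha}\omega_k(f;\delta)_p$. The space $B^\alpha_{p,\theta;k}(\mathbb{R}^n)$ consists of all $f\in L^p(\mathbb{R}^n)$ with $\|f\|_{b^\alpha_{p,\theta;k}}<\infty$. *)

theory Defs
  imports "HOL-Analysis.Analysis"
begin

definition enn_powr :: "ennreal \<Rightarrow> real \<Rightarrow> ennreal" where
  "enn_powr x a = (if x = \<infinity> then \<infinity> else ennreal (enn2real x powr a))"

definition distr_fun :: "('a::euclidean_space \<Rightarrow> real) \<Rightarrow> real \<Rightarrow> ennreal" where
  "distr_fun f s = emeasure lebesgue {x. s < \<bar>f x\<bar>}"

text \<open>Nonincreasing left-continuous rearrangement:
  \<open>f*(t) = sup {\<lambda> \<ge> 0. d_f(\<lambda>) \<ge> t}\<close> (and 0 if this set is empty).\<close>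
definition rearr :: "('a::euclidean_space \<Rightarrow> real) \<Rightarrow> real \<Rightarrow> real" where
  "rearr f t = Sup (insert 0 {s. 0 \<le> s \<and> ennreal t \<le> distr_fun f s})"

definition lorentz_norm :: "('a::euclidean_space \<Rightarrow> real) \<Rightarrow> real \<Rightarrow> ereal \<Rightarrow> ennreal" where
  "lorentz_norm f q \<theta> =
     (if \<theta> = \<infinity> then (SUP t\<in>{0<..}. ennreal (t powr (1/q) * rearr f t))
      else enn_powr (\<integral>\<^sup>+ t\<in>{0<..}. ennreal ((t powr (1/q) * rearr f t) powr real_of_ereal \<theta> / t) \<partial>lborel)
                    (1 / real_of_ereal \<theta>))"

definition part_modulus :: "(real^'n \<Rightarrow> real) \<Rightarrow> 'n \<Rightarrow> real \<Rightarrow> real \<Rightarrow> real" where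
  "part_modulus f k \<delta> p =
     Sup ((\<lambda>h. (\<integral>x. \<bar>f (x + h *\<^sub>R axis k 1) - f x\<bar> powr p \<partial>lebesgue) powr (1/p)) ` {h. \<bar>h\<bar> \<le> \<delta>})"

definition besov_seminorm :: "(real^'n \<Rightarrow> real) \<Rightarrow> real \<Rightarrow> real \<Rightarrow> ereal \<Rightarrow> 'n \<Rightarrow> ennreal" where
  "besov_seminorm f \<alpha> p \<theta> k =
     (if \<theta> = \<infinity> then (SUP \<delta>\<in>{0<..}. ennreal (\<delta> powr (-\<alpha>) * part_modulus f k \<delta> p))
      else enn_powr (\<integral>\<^sup>+ t\<in>{0<..}. ennreal ((t powr (-\<alpha>) * part_modulus f k t p) powr real_of_ereal \<theta> / t) \<partial>lborel)
                    (1 / real_of_ereal \<theta>))"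

definition in_Lp :: "('a::euclidean_space \<Rightarrow> real) \<Rightarrow> real \<Rightarrow> bool" where
  "in_Lp f p \<longleftrightarrow> f \<in> borel_measurable lebesgue \<and> integrable lebesgue (\<lambda>x. \<bar>f x\<bar> powr p)"

definition in_Besov :: "(real^'n \<Rightarrow> real) \<Rightarrow> real \<Rightarrow> real \<Rightarrow> ereal \<Rightarrow> 'n \<Rightarrow> bool" where
  "in_Besov f \<alpha> p \<theta> k \<longleftrightarrow> in_Lp f p \<and> besov_seminorm f \<alpha> p \<theta> k < \<infinity>"

end

theory Submission
  imports Defs
begin

text \<open>
  Averaging \<open>f (x + h) - f x\<close> over a box with half-sides \<open>d j\<close> shows that the decrease of the rearrangement
  from \<open>t\<close> to \<open>\<Prod>j. d j\<close> is at most a constant times \<open>t powr (-1/p)\<close> times the largest of the moduli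
  \<open>\<omega> j (d j)\<close>.  Each modulus has a slowly varying majorant; let \<open>d j m\<close> be the point where the
  majorant of \<open>\<omega> j\<close> equals \<open>2 ^ m\<close>.  For fixed \<open>j\<close> these points grow geometrically in \<open>m\<close>, and the weighted
  values \<open>2 ^ m * d j m powr (- \<beta> j)\<close> are \<open>\<theta> j\<close>-summable with sum controlled by the Besov seminorm.
  With \<open>t m = (\<Prod>j. d j m)\<close> and \<open>f*\<close> the rearrangement of \<open>f\<close>, the numbers \<open>y m = t m powr (1/q) * f* (t m)\<close>
  satisfy \<open>y m \<le> r * y (m + 1) + K * (2 ^ m * t m powr (- \<beta> / n))\<close> with \<open>r < 1\<close>, and the last term is
  the product of the weighted values raised to \<open>\<beta> / (n * \<beta> j)\<close>.  Convexity and the weighted AM-GM inequality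
  sum the recursion.  The factors \<open>1 - \<beta> j\<close> are absorbed in the constant, which may depend on the \<open>\<beta> j\<close>.
\<close>

section \<open>Rearrangements\<close>

lemma distr_fun_antimono:
  assumes "f \<in> borel_measurable lebesgue" "s \<le> s'"
  shows "distr_fun f s' \<le> distr_fun f s"
proof -
  have [measurable]: "f \<in> borel_measurable lebesgue" by fact
  have "{x \<in> space lebesgue. s < \<bar>f x\<bar>} \<in> sets lebesgue" by measurable
  then show ?thesis
    unfolding distr_fun_def using assms(2) by (intro emeasure_mono) auto
qed

lemma distr_fun_Chebyshev:
  assumes f: "in_Lp f p" and p: "0 < p" and s: "0 \<le> s"
  shows "ennreal (s powr p) * distr_fun f s \<le> ennreal (\<integral>x. \<bar>f x\<bar> powr p \<partial>lebesgue)"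
proof -
  have [measurable]: "f \<in> borel_measurable lebesgue" using f by (simp add: in_Lp_def)
  have S: "{x. s < \<bar>f x\<bar>} \<in> sets lebesgue"
  proof -
    have "{x \<in> space lebesgue. s < \<bar>f x\<bar>} \<in> sets lebesgue" by measurable
    then show ?thesis by simp
  qed
  have "ennreal (s powr p) * distr_fun f s = (\<integral>\<^sup>+x. ennreal (s powr p) * indicator {x. s < \<bar>f x\<bar>} x \<partial>lebesgue)"
    unfolding distr_fun_def using S by (simp add: nn_integral_cmult_indicator)
  also have "\<dots> \<le> (\<integral>\<^sup>+x. ennreal (\<bar>f x\<bar> powr p) \<partial>lebesgue)"
    using s p by (intro nn_integral_mono) (auto simp: indicator_def intro!: ennreal_leI powr_mono2)
  also have "\<dots> = ennreal (\<integral>x. \<bar>f x\<bar> powr p \<partial>lebesgue)"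
    using f by (intro nn_integral_eq_integral) (auto simp: in_Lp_def)
  finally show ?thesis .
qed

text \<open>Chebyshev's inequality solved for the level. It bounds every level in the set defining
  \<open>rearr\<close>, which yields both boundedness of that set and the pointwise decay
  \<open>rearr_le\<close>.\<close>

lemma distr_fun_ge_imp_le:
  assumes f: "in_Lp f p" and p: "0 < p" and s: "0 \<le> s" and t: "0 < t" and le: "ennreal t \<le> distr_fun f s"
  shows "s \<le> ((\<integral>x. \<bar>f x\<bar> powr p \<partial>lebesgue) / t) powr (1/p)"
proof -
  let ?I = "\<integral>x. \<bar>f x\<bar> powr p \<partial>lebesgue"
  have "ennreal (s powr p * t) = ennreal (s powr p) * ennreal t"
    using t by (simp add: ennreal_mult)
  also have "\<dots> \<le> ennreal ?I"
    using distr_fun_Chebyshev[OF f p s] le mult_left_mono[OF le, of "ennreal (s powr p)"] by auto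
  finally have "s powr p * t \<le> ?I"
    by (subst (asm) ennreal_le_iff) (auto intro: integral_nonneg_AE)
  then have "s powr p \<le> ?I / t" using t by (simp add: field_simps)
  then have "(s powr p) powr (1/p) \<le> (?I / t) powr (1/p)"
    using p by (intro powr_mono2) auto
  then show ?thesis using p s by (simp add: powr_powr)
qed

text \<open>A real \<open>Sup\<close> is an upper bound only for a set that is bounded above;
  integrability of the \<open>p\<close>-th power provides this.\<close>

lemma rearr_bdd_above:
  assumes "in_Lp f p" "0 < p" "0 < t"
  shows "bdd_above (insert 0 {s. 0 \<le> s \<and> ennreal t \<le> distr_fun f s})"
  using distr_fun_ge_imp_le[OF assms(1,2) _ assms(3)]
  by (intro bdd_aboveI[of _ "((\<integral>x. \<bar>f x\<bar> powr p \<partial>lebesgue) / t) powr (1/p)"]) auto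

lemma rearr_nonneg:
  assumes "in_Lp f p" "0 < p" "0 < t"
  shows "0 \<le> rearr f t"
  unfolding rearr_def by (rule cSup_upper[OF _ rearr_bdd_above[OF assms]]) simp

lemma rearr_le:
  assumes "in_Lp f p" "0 < p" "0 < t"
  shows "rearr f t \<le> ((\<integral>x. \<bar>f x\<bar> powr p \<partial>lebesgue) / t) powr (1/p)"
  unfolding rearr_def using distr_fun_ge_imp_le[OF assms(1,2) _ assms(3)]
  by (intro cSup_least) auto

lemma rearr_antimono:
  assumes "in_Lp f p" "0 < p" "0 < t" "t \<le> t'"
  shows "rearr f t' \<le> rearr f t"
  unfolding rearr_def
proof (rule cSup_subset_mono)
  show "bdd_above (insert 0 {s. 0 \<le> s \<and> ennreal t \<le> distr_fun f s})"
    by (rule rearr_bdd_above[OF assms(1-3)])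
  show "insert 0 {s. 0 \<le> s \<and> ennreal t' \<le> distr_fun f s} \<subseteq> insert 0 {s. 0 \<le> s \<and> ennreal t \<le> distr_fun f s}"
    using ennreal_leI[OF assms(4)] by (auto intro: order_trans)
qed simp

text \<open>Together with \<open>rearr_less_imp\<close> this turns strict inequalities for the
  rearrangement into measures of level sets, the form in which the box average uses them.\<close>

lemma less_rearr_imp:
  assumes "in_Lp f p" "0 \<le> s" "s < rearr f t"
  shows "ennreal t \<le> distr_fun f s"
proof -
  have "\<exists>x\<in>insert 0 {s. 0 \<le> s \<and> ennreal t \<le> distr_fun f s}. s < x"
  proof (rule ccontr)
    assume "\<not> ?thesis"
    then have "rearr f t \<le> s" unfolding rearr_def by (intro cSup_least) (auto simp: not_less)
    then show False using assms(3) by simp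
  qed
  then obtain s' where "s < s'" "ennreal t \<le> distr_fun f s'"
    using assms(2) by auto
  then show ?thesis
    using distr_fun_antimono[of f s s'] assms(1) by (auto simp: in_Lp_def intro: order_trans)
qed

lemma rearr_less_imp:
  assumes "in_Lp f p" "0 < p" "0 < t" "rearr f t < s"
  shows "distr_fun f s < ennreal t"
proof (rule ccontr)
  assume "\<not> ?thesis"
  then have "s \<in> insert 0 {s. 0 \<le> s \<and> ennreal t \<le> distr_fun f s}"
    using rearr_nonneg[OF assms(1-3)] assms(4) by (auto simp: not_less)
  then have "s \<le> rearr f t" unfolding rearr_def by (rule cSup_upper) (rule rearr_bdd_above[OF assms(1-3)])
  then show False using assms(4) by simp
qed

section \<open>Translation differences and the modulus of continuity\<close>

lemma lborel_AE_translate: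
  fixes v :: "'a::euclidean_space"
  assumes "AE x in lborel. P x"
  shows "AE x in lborel. P (x + v)"
proof -
  obtain N where N: "N \<in> null_sets lborel" "{x \<in> space lborel. \<not> P x} \<subseteq> N"
    using assms unfolding eventually_ae_filter by auto
  have [measurable]: "N \<in> sets borel" using N by auto
  have "AE x in distr lborel borel ((+) v). x \<notin> N"
    unfolding lborel_distr_plus by (rule AE_not_in[OF N(1)])
  then have "AE x in lborel. v + x \<notin> N"
    by (subst (asm) AE_distr_iff) auto
  then show ?thesis
    by (rule AE_mp, intro AE_I2) (use N(2) in \<open>auto simp: add.commute\<close>)
qed

text \<open>With the completion as target, preimages of null sets must be null as well; this holds
  because translation preserves \<open>lborel\<close>.\<close>

lemma translation_measurable_lebesgue:
  fixes v :: "'a::euclidean_space"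
  shows "(\<lambda>x. x + v) \<in> lebesgue \<rightarrow>\<^sub>M lebesgue"
proof (rule completion.measurable_completion2)
  have m: "(\<lambda>x. x + v) \<in> lborel \<rightarrow>\<^sub>M lborel" by simp
  show "(\<lambda>x. x + v) \<in> lebesgue \<rightarrow>\<^sub>M lborel" by (rule measurable_completion[OF m])
  have "distr lebesgue lborel (\<lambda>x. x + v) = distr lborel lborel (\<lambda>x. x + v)"
    by (rule distr_completion[OF m])
  also have "\<dots> = lborel"
    using lborel_distr_plus[of v] by (simp add: add.commute[of _ v] cong: distr_cong)
  finally show "null_sets lborel \<subseteq> null_sets (distr lebesgue lborel (\<lambda>x. x + v))" by simp
qed

lemma nn_integral_lborel_translate:
  fixes v :: "'a::euclidean_space"
  assumes [measurable]: "g \<in> borel_measurable borel"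
  shows "(\<integral>\<^sup>+x. g (x + v) \<partial>lborel) = (\<integral>\<^sup>+x. g x \<partial>lborel)"
proof -
  have "(\<integral>\<^sup>+x. g x \<partial>lborel) = (\<integral>\<^sup>+x. g x \<partial>distr lborel borel ((+) v))"
    by (simp add: lborel_distr_plus)
  also have "\<dots> = (\<integral>\<^sup>+x. g (v + x) \<partial>lborel)"
    by (subst nn_integral_distr) auto
  finally show ?thesis by (simp add: add.commute)
qed

text \<open>A crude substitute for Minkowski's inequality that works directly with
  \<open>p\<close>-th powers. Its constant is harmless, since it depends on \<open>p\<close>
  alone.\<close>

lemma abs_diff_powr_le:
  fixes a b c p :: real
  assumes "0 \<le> p"
  shows "\<bar>a - c\<bar> powr p \<le> 2 powr p * (\<bar>a - b\<bar> powr p + \<bar>b - c\<bar> powr p)"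
proof -
  have "\<bar>a - c\<bar> powr p \<le> (2 * max \<bar>a - b\<bar> \<bar>b - c\<bar>) powr p"
    using assms by (intro powr_mono2) (auto simp: max_def abs_if)
  also have "\<dots> = 2 powr p * (max \<bar>a - b\<bar> \<bar>b - c\<bar>) powr p"
    by (simp add: powr_mult)
  also have "\<dots> \<le> 2 powr p * (\<bar>a - b\<bar> powr p + \<bar>b - c\<bar> powr p)"
    by (intro mult_left_mono) (auto simp: max_def)
  finally show ?thesis .
qed

text \<open>A Borel representative makes the difference \<open>f (x + h) - f x\<close> jointly measurable in
  \<open>(x, h)\<close>, as Tonelli's theorem requires.\<close>

lemma in_Lp_Borel_representative:
  assumes "in_Lp f p"
  obtains g where "g \<in> borel_measurable borel" "AE x in lborel. f x = g x"
  using assms completion_ex_borel_measurable_real[of f lborel] by (auto simp: in_Lp_def)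

lemma nn_integral_translate_diff_eq:
  fixes f g :: "'a::euclidean_space \<Rightarrow> real"
  assumes "AE x in lborel. f x = g x"
  shows "(\<integral>\<^sup>+x. ennreal (\<bar>f (x + v) - f x\<bar> powr p) \<partial>lebesgue)
    = (\<integral>\<^sup>+x. ennreal (\<bar>g (x + v) - g x\<bar> powr p) \<partial>lborel)"
proof -
  have "AE x in lborel. ennreal (\<bar>f (x + v) - f x\<bar> powr p) = ennreal (\<bar>g (x + v) - g x\<bar> powr p)"
    using assms lborel_AE_translate[OF assms, of v] by eventually_elim simp
  then show ?thesis
    unfolding nn_integral_completion by (intro nn_integral_cong_AE)
qed

lemma nn_integral_translate_diff_le:
  fixes f :: "'a::euclidean_space \<Rightarrow> real"
  assumes f: "in_Lp f p" and p: "0 < p"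
  shows "(\<integral>\<^sup>+x. ennreal (\<bar>f (x + v) - f x\<bar> powr p) \<partial>lebesgue)
    \<le> ennreal (2 powr p * 2 * (\<integral>x. \<bar>f x\<bar> powr p \<partial>lebesgue))"
proof -
  let ?I = "\<integral>x. \<bar>f x\<bar> powr p \<partial>lebesgue"
  obtain g where g[measurable]: "g \<in> borel_measurable borel" and fg: "AE x in lborel. f x = g x"
    using in_Lp_Borel_representative[OF f] by blast
  have G: "(\<integral>\<^sup>+x. ennreal (\<bar>g x\<bar> powr p) \<partial>lborel) = ennreal ?I"
  proof -
    have "(\<integral>\<^sup>+x. ennreal (\<bar>g x\<bar> powr p) \<partial>lborel) = (\<integral>\<^sup>+x. ennreal (\<bar>f x\<bar> powr p) \<partial>lborel)"
      using fg by (intro nn_integral_cong_AE) auto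
    also have "\<dots> = (\<integral>\<^sup>+x. ennreal (\<bar>f x\<bar> powr p) \<partial>lebesgue)" by (simp add: nn_integral_completion)
    also have "\<dots> = ennreal ?I" using f by (intro nn_integral_eq_integral) (auto simp: in_Lp_def)
    finally show ?thesis .
  qed
  have "(\<integral>\<^sup>+x. ennreal (\<bar>g (x + v) - g x\<bar> powr p) \<partial>lborel)
    \<le> (\<integral>\<^sup>+x. ennreal (2 powr p) * (ennreal (\<bar>g (x + v)\<bar> powr p) + ennreal (\<bar>g x\<bar> powr p)) \<partial>lborel)"
  proof (rule nn_integral_mono)
    fix x
    have "\<bar>g (x + v) - g x\<bar> powr p \<le> 2 powr p * (\<bar>g (x + v)\<bar> powr p + \<bar>g x\<bar> powr p)"
      using abs_diff_powr_le[of p "g (x+v)" "g x" 0] p by simp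
    then show "ennreal (\<bar>g (x + v) - g x\<bar> powr p) \<le> ennreal (2 powr p) * (ennreal (\<bar>g (x + v)\<bar> powr p) + ennreal (\<bar>g x\<bar> powr p))"
      by (simp flip: ennreal_plus ennreal_mult)
  qed
  also have "\<dots> = ennreal (2 powr p) * (ennreal ?I + ennreal ?I)"
    using nn_integral_lborel_translate[of "\<lambda>x. ennreal (\<bar>g x\<bar> powr p)" v]
    by (simp add: nn_integral_cmult nn_integral_add G)
  also have "\<dots> = ennreal (2 powr p * 2 * ?I)"
    by (simp add: integral_nonneg_AE flip: ennreal_plus ennreal_mult)
  finally show ?thesis
    by (simp add: nn_integral_translate_diff_eq[OF fg])
qed

text \<open>\<open>part_modulus\<close> is built from the Bochner integral, which is 0 by default
  for nonintegrable functions. Integrability makes it agree with the nonnegative integral, and the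
  bound uniform in \<open>v\<close> keeps the supremum in \<open>part_modulus\<close>
  finite.\<close>

lemma translate_diff_integral:
  fixes f :: "'a::euclidean_space \<Rightarrow> real"
  assumes f: "in_Lp f p" and p: "0 < p"
  shows "(\<integral>\<^sup>+x. ennreal (\<bar>f (x + v) - f x\<bar> powr p) \<partial>lebesgue)
    = ennreal (\<integral>x. \<bar>f (x + v) - f x\<bar> powr p \<partial>lebesgue)"
    and "(\<integral>x. \<bar>f (x + v) - f x\<bar> powr p \<partial>lebesgue) \<le> 2 powr p * 2 * (\<integral>x. \<bar>f x\<bar> powr p \<partial>lebesgue)"
proof -
  have [measurable]: "f \<in> borel_measurable lebesgue" using f by (simp add: in_Lp_def)
  have [measurable]: "(\<lambda>x. f (x + v)) \<in> borel_measurable lebesgue"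
    by (rule measurable_compose[OF translation_measurable_lebesgue]) simp
  have le: "(\<integral>\<^sup>+x. ennreal (\<bar>f (x + v) - f x\<bar> powr p) \<partial>lebesgue)
    \<le> ennreal (2 powr p * 2 * (\<integral>x. \<bar>f x\<bar> powr p \<partial>lebesgue))"
    by (rule nn_integral_translate_diff_le[OF f p])
  have "integrable lebesgue (\<lambda>x. \<bar>f (x + v) - f x\<bar> powr p)"
    by (rule integrableI_bounded) (use le in \<open>auto intro: le_less_trans\<close>)
  then show eq: "(\<integral>\<^sup>+x. ennreal (\<bar>f (x + v) - f x\<bar> powr p) \<partial>lebesgue)
    = ennreal (\<integral>x. \<bar>f (x + v) - f x\<bar> powr p \<partial>lebesgue)"
    by (rule nn_integral_eq_integral) simp
  show "(\<integral>x. \<bar>f (x + v) - f x\<bar> powr p \<partial>lebesgue) \<le> 2 powr p * 2 * (\<integral>x. \<bar>f x\<bar> powr p \<partial>lebesgue)"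
    using le unfolding eq by (subst (asm) ennreal_le_iff) (auto intro!: mult_nonneg_nonneg integral_nonneg_AE)
qed

lemma part_modulus_bdd_above:
  fixes f :: "real^'n \<Rightarrow> real"
  assumes f: "in_Lp f p" and p: "0 < p"
  shows "bdd_above ((\<lambda>h. (\<integral>x. \<bar>f (x + h *\<^sub>R axis k 1) - f x\<bar> powr p \<partial>lebesgue) powr (1/p)) ` S)"
  using translate_diff_integral(2)[OF f p] p
  by (intro bdd_aboveI[of _ "(2 powr p * 2 * (\<integral>x. \<bar>f x\<bar> powr p \<partial>lebesgue)) powr (1/p)"])
     (auto intro!: powr_mono2 integral_nonneg_AE)

lemma part_modulus_mono:
  assumes "in_Lp f p" "0 < p" "0 \<le> \<delta>" "\<delta> \<le> \<delta>'"
  shows "part_modulus f k \<delta> p \<le> part_modulus f k \<delta>' p"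
  unfolding part_modulus_def
  by (rule cSup_subset_mono[OF _ part_modulus_bdd_above[OF assms(1,2)]])
     (use assms in \<open>auto intro: exI[of _ 0]\<close>)

lemma part_modulus_upper:
  assumes "in_Lp f p" "0 < p" "\<bar>h\<bar> \<le> \<delta>"
  shows "(\<integral>x. \<bar>f (x + h *\<^sub>R axis k 1) - f x\<bar> powr p \<partial>lebesgue) powr (1/p) \<le> part_modulus f k \<delta> p"
  unfolding part_modulus_def
  by (rule cSup_upper[OF _ part_modulus_bdd_above[OF assms(1,2)]]) (use assms in auto)

lemma part_modulus_nonneg:
  assumes "in_Lp f p" "0 < p" "0 \<le> \<delta>"
  shows "0 \<le> part_modulus f k \<delta> p"
  using part_modulus_upper[OF assms(1,2), of 0 \<delta> k] assms(3) by simp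

lemma nn_integral_axis_translate_diff_le:
  assumes "in_Lp f p" "0 < p" "\<bar>h\<bar> \<le> \<delta>" "part_modulus f k \<delta> p \<le> u"
  shows "(\<integral>\<^sup>+x. ennreal (\<bar>f (x + h *\<^sub>R axis k 1) - f x\<bar> powr p) \<partial>lebesgue) \<le> ennreal (u powr p)"
proof -
  let ?J = "\<integral>x. \<bar>f (x + h *\<^sub>R axis k 1) - f x\<bar> powr p \<partial>lebesgue"
  have J: "0 \<le> ?J" by (intro integral_nonneg_AE) auto
  have "?J powr (1/p) \<le> u" using part_modulus_upper[OF assms(1-3)] assms(4) by (rule order_trans)
  then have "(?J powr (1/p)) powr p \<le> u powr p" using assms(2) by (intro powr_mono2) auto
  then have "?J \<le> u powr p" using assms(2) J by (simp add: powr_powr)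
  then show ?thesis by (simp add: translate_diff_integral(1)[OF assms(1,2)] ennreal_leI)
qed

section \<open>Box averages and the decrease of the rearrangement\<close>

text \<open>The shift \<open>h\<close> is performed one coordinate at a time, by induction on the
  set of coordinates already used. Translation invariance removes the shift by \<open>b\<close> from
  the first of the two differences.\<close>

lemma nn_integral_box_translate_diff_le:
  fixes g :: "real^'n \<Rightarrow> real"
  assumes g[measurable]: "g \<in> borel_measurable borel" and p: "1 \<le> p"
    and u: "\<And>j r. \<bar>r\<bar> \<le> d j \<Longrightarrow> (\<integral>\<^sup>+x. ennreal (\<bar>g (x + r *\<^sub>R axis j 1) - g x\<bar> powr p) \<partial>lborel) \<le> ennreal U"
    and U: "0 \<le> U" and h: "\<And>j. \<bar>h $ j\<bar> \<le> d j"
  shows "(\<integral>\<^sup>+x. ennreal (\<bar>g (x + h) - g x\<bar> powr p) \<partial>lborel) \<le> ennreal ((4 powr p) ^ CARD('n) * U)"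
proof -
  have "(\<integral>\<^sup>+x. ennreal (\<bar>g (x + (\<Sum>j\<in>J. (h $ j) *\<^sub>R axis j 1)) - g x\<bar> powr p) \<partial>lborel)
      \<le> ennreal ((4 powr p) ^ card J * U)" if "finite J" for J :: "'n set"
    using that
  proof induction
    case empty
    then show ?case using p by simp
  next
    case (insert k J)
    define a where "a = (\<Sum>j\<in>J. (h $ j) *\<^sub>R axis j (1::real))"
    define b where "b = (h $ k) *\<^sub>R axis k (1::real)"
    have "(\<integral>\<^sup>+x. ennreal (\<bar>g (x + (b + a)) - g x\<bar> powr p) \<partial>lborel)
      \<le> (\<integral>\<^sup>+x. ennreal (2 powr p) * (ennreal (\<bar>g ((x + b) + a) - g (x + b)\<bar> powr p)
            + ennreal (\<bar>g (x + b) - g x\<bar> powr p)) \<partial>lborel)"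
    proof (rule nn_integral_mono)
      fix x
      have "\<bar>g (x + (b + a)) - g x\<bar> powr p
         \<le> 2 powr p * (\<bar>g ((x + b) + a) - g (x + b)\<bar> powr p + \<bar>g (x + b) - g x\<bar> powr p)"
        using abs_diff_powr_le[of p "g (x + (b + a))" "g x" "g (x + b)"] p by (simp add: add.assoc)
      then show "ennreal (\<bar>g (x + (b + a)) - g x\<bar> powr p) \<le> ennreal (2 powr p) *
          (ennreal (\<bar>g ((x + b) + a) - g (x + b)\<bar> powr p) + ennreal (\<bar>g (x + b) - g x\<bar> powr p))"
        by (simp flip: ennreal_plus ennreal_mult)
    qed
    also have "\<dots> = ennreal (2 powr p) * ((\<integral>\<^sup>+x. ennreal (\<bar>g (x + a) - g x\<bar> powr p) \<partial>lborel)
            + (\<integral>\<^sup>+x. ennreal (\<bar>g (x + b) - g x\<bar> powr p) \<partial>lborel))"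
      using nn_integral_lborel_translate[of "\<lambda>x. ennreal (\<bar>g (x + a) - g x\<bar> powr p)" b]
      by (simp add: nn_integral_cmult nn_integral_add)
    also have "\<dots> \<le> ennreal (2 powr p) * (ennreal ((4 powr p) ^ card J * U) + ennreal U)"
      using insert.IH u[OF h[of k]] unfolding a_def b_def by (intro mult_left_mono add_mono) auto
    also have "\<dots> = ennreal (2 powr p * ((4 powr p) ^ card J * U + U))"
      using U by (simp flip: ennreal_plus ennreal_mult)
    \<comment> \<open>One more coordinate costs \<open>4 powr p\<close>: a factor
      \<open>2 powr p\<close> from splitting the difference, and a factor 2 from adding two terms,
      which is at most \<open>2 powr p\<close> because \<open>1 \<le> p\<close>.\<close>
    also have "\<dots> \<le> ennreal ((4 powr p) ^ card (insert k J) * U)"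
    proof (rule ennreal_leI)
      have 1: "1 \<le> (4 powr p) ^ card J" using p by (intro one_le_power ge_one_powr_ge_zero) auto
      have 2: "2 \<le> 2 powr p" using powr_mono[of 1 p 2] p by simp
      have 4: "4 powr p = 2 powr p * 2 powr p" by (simp flip: powr_mult)
      have "2 powr p * ((4 powr p) ^ card J * U + U) \<le> 2 powr p * (2 * (4 powr p) ^ card J * U)"
        using mult_right_mono[OF 1 U] by (intro mult_left_mono) (auto simp: mult.commute)
      also have "\<dots> \<le> 2 powr p * (2 powr p * (4 powr p) ^ card J * U)"
        using 2 U by (intro mult_left_mono mult_right_mono) auto
      also have "\<dots> = (4 powr p) ^ card (insert k J) * U"
        using insert.hyps by (simp add: 4)
      finally show "2 powr p * ((4 powr p) ^ card J * U + U) \<le> (4 powr p) ^ card (insert k J) * U" .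
    qed
    finally show ?case using insert.hyps by (simp add: a_def b_def)
  qed
  from this[of UNIV] show ?thesis
    using basis_expansion[of h] by (simp add: scalar_mult_eq_scaleR)
qed

text \<open>Averaging over a box of side lengths \<open>2 d j\<close>: a point where \<open>\<bar>f\<bar>\<close> exceeds \<open>s\<close> has at
  least half of the box translates outside the small set \<open>{\<bar>f\<bar> > s'}\<close>.\<close>

lemma level_set_diff_le:
  fixes g :: "real^'n \<Rightarrow> real"
  assumes g[measurable]: "g \<in> borel_measurable borel" and p: "1 \<le> p" and d: "\<And>j. 0 < d j"
    and u: "\<And>j r. \<bar>r\<bar> \<le> d j \<Longrightarrow> (\<integral>\<^sup>+x. ennreal (\<bar>g (x + r *\<^sub>R axis j 1) - g x\<bar> powr p) \<partial>lborel) \<le> ennreal U"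
    and U: "0 \<le> U" and s: "0 \<le> s'" "s' < s" and t: "0 < t"
    and A: "ennreal t \<le> emeasure lborel {x. s < \<bar>g x\<bar>}"
    and B: "emeasure lborel {x. s' < \<bar>g x\<bar>} \<le> ennreal (\<Prod>j\<in>UNIV. d j)"
  shows "t * (s - s') powr p \<le> 2 * (4 powr p) ^ CARD('n) * U"
proof -
  define T where "T = (\<Prod>j\<in>UNIV. d j)"
  have T: "0 < T" unfolding T_def by (intro prod_pos) (use d in auto)
  define V where "V = 2 ^ CARD('n) * T"
  define Q where "Q = cbox (\<chi> j. - d j) (\<chi> j. d j)"
  have Qm[measurable]: "Q \<in> sets borel" unfolding Q_def by simp
  have Qmem: "h \<in> Q \<longleftrightarrow> (\<forall>j. \<bar>h $ j\<bar> \<le> d j)" for h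
    unfolding Q_def mem_box_cart by (auto simp: abs_le_iff minus_le_iff)
  have ne: "Q \<noteq> {}" using d Qmem[of 0] by (auto simp: less_imp_le)
  have Qe: "emeasure lborel Q = ennreal V"
  proof -
    have "measure lborel Q = (\<Prod>j\<in>UNIV. 2 * d j)"
      using ne unfolding Q_def by (subst content_cbox_cart) auto
    also have "\<dots> = V" unfolding V_def T_def by (simp add: prod.distrib)
    finally have "measure lborel Q = V" .
    moreover have "emeasure lborel Q \<noteq> top" unfolding Q_def by (simp add: emeasure_lborel_cbox_eq)
    ultimately show ?thesis by (metis emeasure_eq_ennreal_measure)
  qed
  \<comment> \<open>There is at least one coordinate, so removing a set of measure at most
    \<open>T\<close> from \<open>Q\<close> leaves at least half of \<open>Q\<close>.\<close>
  have V: "2 * T \<le> V"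
  proof -
    have "(2::real) ^ 1 \<le> 2 ^ CARD('n)" by (intro power_increasing) (auto simp: Suc_le_eq)
    then show ?thesis unfolding V_def using T by simp
  qed
  let ?A = "{x. s < \<bar>g x\<bar>}" and ?B = "{x. s' < \<bar>g x\<bar>}"
  have Am[measurable]: "?A \<in> sets borel" by measurable
  have Bm[measurable]: "?B \<in> sets borel" by measurable
  define F where "F = (\<lambda>x h. ennreal (\<bar>g (x + h) - g x\<bar> powr p) * indicator Q h)"
  have Fm: "(\<lambda>(x, h). F x h) \<in> borel_measurable (lborel \<Otimes>\<^sub>M lborel)"
    unfolding F_def by measurable
  have inner: "ennreal ((s - s') powr p * (V / 2)) \<le> (\<integral>\<^sup>+h. F x h \<partial>lborel)" if x: "x \<in> ?A" for x
  proof -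
    \<comment> \<open>\<open>C\<close> collects the shifts that move \<open>x\<close> into
      \<open>?B\<close>. It is a translate of \<open>?B\<close>, hence of measure at most
      \<open>T\<close>; for a shift in \<open>Q - C\<close> the difference is at least
      \<open>s - s'\<close>.\<close>
    define C where "C = {h. s' < \<bar>g (h + x)\<bar>}"
    have [measurable]: "C \<in> sets borel" unfolding C_def by measurable
    have "emeasure lborel C = (\<integral>\<^sup>+h. indicator ?B (h + x) \<partial>lborel)"
    proof -
      have "(\<integral>\<^sup>+h. indicator ?B (h + x) \<partial>lborel) = (\<integral>\<^sup>+h. indicator C h \<partial>lborel)"
        by (intro nn_integral_cong) (auto simp: indicator_def C_def)
      then show ?thesis by simp
    qed
    also have "\<dots> = (\<integral>\<^sup>+h. indicator ?B h \<partial>lborel)"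
      by (rule nn_integral_lborel_translate) measurable
    also have "\<dots> = emeasure lborel ?B" by simp
    finally have C: "emeasure lborel C \<le> ennreal T" using B by (simp add: T_def)
    have "ennreal V \<le> emeasure lborel (Q - C) + emeasure lborel C"
    proof -
      have "ennreal V \<le> emeasure lborel ((Q - C) \<union> C)"
        unfolding Qe[symmetric] by (intro emeasure_mono) auto
      also have "\<dots> \<le> emeasure lborel (Q - C) + emeasure lborel C"
        by (intro emeasure_subadditive) auto
      finally show ?thesis .
    qed
    also have "\<dots> \<le> emeasure lborel (Q - C) + ennreal T" using C by (intro add_left_mono)
    finally have "ennreal V - ennreal T \<le> emeasure lborel (Q - C)"
      by (simp add: ennreal_minus_le_iff add.commute)
    moreover have "ennreal (V / 2) \<le> ennreal V - ennreal T"
      using V T by (simp add: ennreal_minus ennreal_leI)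
    ultimately have QC: "ennreal (V / 2) \<le> emeasure lborel (Q - C)" by (rule order_trans[rotated])
    have "ennreal ((s - s') powr p * (V / 2)) = ennreal ((s - s') powr p) * ennreal (V / 2)"
      using V T by (intro ennreal_mult) auto
    also have "\<dots> \<le> ennreal ((s - s') powr p) * emeasure lborel (Q - C)"
      using QC by (intro mult_left_mono) auto
    also have "\<dots> = (\<integral>\<^sup>+h. ennreal ((s - s') powr p) * indicator (Q - C) h \<partial>lborel)"
      by (simp add: nn_integral_cmult_indicator)
    also have "\<dots> \<le> (\<integral>\<^sup>+h. F x h \<partial>lborel)"
    proof (intro nn_integral_mono)
      fix h
      show "ennreal ((s - s') powr p) * indicator (Q - C) h \<le> F x h"
      proof (cases "h \<in> Q - C")
        case True
        then have "\<bar>g (x + h)\<bar> \<le> s'" by (simp add: C_def add.commute)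
        then have "s - s' \<le> \<bar>g (x + h) - g x\<bar>" using x by simp
        then show ?thesis using True s p unfolding F_def by (auto intro!: ennreal_leI powr_mono2)
      qed simp
    qed
    finally show ?thesis .
  qed
  have "ennreal (t * ((s - s') powr p * (V / 2))) = ennreal ((s - s') powr p * (V / 2)) * ennreal t"
    using V T t by (subst ennreal_mult[symmetric]) (auto simp: mult_ac)
  also have "\<dots> \<le> ennreal ((s - s') powr p * (V / 2)) * emeasure lborel ?A"
    by (intro mult_left_mono A) auto
  also have "\<dots> = (\<integral>\<^sup>+x. ennreal ((s - s') powr p * (V / 2)) * indicator ?A x \<partial>lborel)"
    by (simp add: nn_integral_cmult_indicator)
  also have "\<dots> \<le> (\<integral>\<^sup>+x. \<integral>\<^sup>+h. F x h \<partial>lborel \<partial>lborel)"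
    using inner by (intro nn_integral_mono) (auto simp: indicator_def)
  \<comment> \<open>Tonelli: the lower bound came from fixing \<open>x\<close>, whereas the moduli
    control the integral over \<open>x\<close> for a fixed shift in the box.\<close>
  also have "\<dots> = (\<integral>\<^sup>+h. \<integral>\<^sup>+x. F x h \<partial>lborel \<partial>lborel)"
    by (rule lborel_pair.Fubini'[OF Fm, symmetric])
  also have "\<dots> \<le> (\<integral>\<^sup>+h. ennreal ((4 powr p) ^ CARD('n) * U) * indicator Q h \<partial>lborel)"
  proof (intro nn_integral_mono)
    fix h
    show "(\<integral>\<^sup>+x. F x h \<partial>lborel) \<le> ennreal ((4 powr p) ^ CARD('n) * U) * indicator Q h"
      using nn_integral_box_translate_diff_le[OF g p u U, where h=h]
      by (auto simp: F_def indicator_def Qmem)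
  qed
  also have "\<dots> = ennreal ((4 powr p) ^ CARD('n) * U * V)"
    using Qe U V T by (simp add: nn_integral_cmult_indicator ennreal_mult)
  finally have "t * ((s - s') powr p * (V / 2)) \<le> (4 powr p) ^ CARD('n) * U * V"
    using U V T by (subst (asm) ennreal_le_iff) auto
  then have "(t * (s - s') powr p) * V \<le> (2 * (4 powr p) ^ CARD('n) * U) * V" by (simp add: field_simps)
  then show ?thesis using V T by (subst (asm) mult_le_cancel_right) auto
qed

text \<open>If the decrease were larger, two levels \<open>s' < s\<close> would fit strictly between
  the two values of the rearrangement with a gap above \<open>K * u\<close>, contradicting
  \<open>level_set_diff_le\<close>.\<close>

lemma rearr_diff_le:
  fixes f :: "real^'n \<Rightarrow> real"
  assumes f: "in_Lp f p" and p: "1 \<le> p" and d: "\<And>j. 0 < d j"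
    and u: "\<And>j. part_modulus f j (d j) p \<le> u" and t: "0 < t"
  shows "rearr f t \<le> rearr f (\<Prod>j\<in>UNIV. d j) + (2 * (4 powr p) ^ CARD('n) / t) powr (1/p) * u"
proof (rule ccontr)
  define T where "T = (\<Prod>j\<in>UNIV. d j)"
  have T: "0 < T" unfolding T_def by (intro prod_pos) (use d in auto)
  define K where "K = (2 * (4 powr p) ^ CARD('n) / t) powr (1/p)"
  have p0: "0 < p" using p by simp
  have u0: "0 \<le> u" using part_modulus_nonneg[OF f p0 less_imp_le[OF d]] u order_trans by blast
  assume "\<not> ?thesis"
  then have gt: "rearr f T + K * u < rearr f t" by (simp add: T_def K_def not_le)
  \<comment> \<open>A third of the excess: moving both levels inward by \<open>e\<close> still
    leaves the gap \<open>K * u + e\<close>.\<close>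
  define e where "e = (rearr f t - rearr f T - K * u) / 3"
  have e: "0 < e" using gt by (simp add: e_def)
  define s where "s = rearr f t - e"
  define s' where "s' = rearr f T + e"
  have K0: "0 \<le> K" by (simp add: K_def)
  have ss: "K * u < s - s'" using e by (simp add: s_def s'_def e_def field_simps)
  have "0 \<le> K * u" using K0 u0 by simp
  then have s'0: "0 \<le> s'" "s' < s" using rearr_nonneg[OF f p0 T] e ss by (auto simp: s'_def)
  obtain g where g[measurable]: "g \<in> borel_measurable borel" and fg: "AE x in lborel. f x = g x"
    using in_Lp_Borel_representative[OF f] by blast
  have fgd: "distr_fun f r = emeasure lborel {x. r < \<bar>g x\<bar>}" for r
  proof -
    have "{x \<in> space lebesgue. r < \<bar>f x\<bar>} \<in> sets lebesgue"
      using f by (intro borel_measurable_less borel_measurable_abs) (auto simp: in_Lp_def)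
    then have "distr_fun f r = (\<integral>\<^sup>+x. indicator {x. r < \<bar>f x\<bar>} x \<partial>lebesgue)"
      unfolding distr_fun_def by (subst nn_integral_indicator) auto
    also have "\<dots> = (\<integral>\<^sup>+x. indicator {x. r < \<bar>g x\<bar>} x \<partial>lborel)"
      unfolding nn_integral_completion using fg by (intro nn_integral_cong_AE) (auto simp: indicator_def)
    also have "\<dots> = emeasure lborel {x. r < \<bar>g x\<bar>}" by (intro nn_integral_indicator) measurable
    finally show ?thesis .
  qed
  have "t * (s - s') powr p \<le> 2 * (4 powr p) ^ CARD('n) * (u powr p)"
  proof (rule level_set_diff_le[OF g p d _ _ s'0 t])
    show "ennreal t \<le> emeasure lborel {x. s < \<bar>g x\<bar>}"
      unfolding fgd[symmetric] using s'0 e by (intro less_rearr_imp[OF f]) (auto simp: s_def)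
    show "emeasure lborel {x. s' < \<bar>g x\<bar>} \<le> ennreal (\<Prod>j\<in>UNIV. d j)"
      unfolding fgd[symmetric] T_def[symmetric] using e
      by (intro less_imp_le rearr_less_imp[OF f p0 T]) (auto simp: s'_def)
    show "(\<integral>\<^sup>+x. ennreal (\<bar>g (x + r *\<^sub>R axis j 1) - g x\<bar> powr p) \<partial>lborel) \<le> ennreal (u powr p)"
      if "\<bar>r\<bar> \<le> d j" for j r
      using nn_integral_axis_translate_diff_le[OF f p0 that u] by (simp add: nn_integral_translate_diff_eq[OF fg])
  qed simp
  then have "(s - s') powr p \<le> (2 * (4 powr p) ^ CARD('n) / t) * (u powr p)"
    using t by (simp add: field_simps)
  then have "((s - s') powr p) powr (1/p) \<le> ((2 * (4 powr p) ^ CARD('n) / t) * (u powr p)) powr (1/p)"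
    using p by (intro powr_mono2) auto
  also have "\<dots> = K * u"
    using u0 p t by (subst powr_mult) (auto simp: K_def powr_powr)
  finally have "s - s' \<le> K * u" using s'0 p by (simp add: powr_powr)
  then show False using ss by simp
qed

section \<open>Level points of a slowly varying majorant\<close>

lemma sum_le_geometric:
  fixes F :: "'a \<Rightarrow> real" and \<rho> :: real
  assumes "finite S" "inj_on \<phi> S" "0 \<le> \<rho>" "\<rho> < 1" "\<And>m. m \<in> S \<Longrightarrow> F m \<le> \<rho> ^ \<phi> m"
  shows "(\<Sum>m\<in>S. F m) \<le> 1 / (1 - \<rho>)"
proof -
  have "(\<Sum>m\<in>S. F m) \<le> (\<Sum>m\<in>S. \<rho> ^ \<phi> m)" using assms by (intro sum_mono) auto
  also have "\<dots> = (\<Sum>i\<in>\<phi> ` S. \<rho> ^ i)" using assms by (simp add: sum.reindex)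
  also have "\<dots> \<le> (\<Sum>i. \<rho> ^ i)"
    using assms by (intro sum_le_suminf) (auto intro: summable_geometric)
  also have "\<dots> = 1 / (1 - \<rho>)" using assms by (intro suminf_geometric) auto
  finally show ?thesis .
qed

lemma separated_growth:
  fixes x :: "int \<Rightarrow> real"
  assumes "\<And>m. x m + l \<le> x (m + 1)" "k \<le> m"
  shows "x k + real_of_int (m - k) * l \<le> x m"
  using assms(2)
proof (induction m rule: int_ge_induct)
  case base
  then show ?case by simp
next
  case (step i)
  then show ?case using assms(1)[of i] by (simp add: algebra_simps)
qed

text \<open>The points are split at \<open>c\<close>. On each side the distance to \<open>c\<close>
  grows at least linearly in the index counted from the point nearest to \<open>c\<close>, so each
  side is dominated by a geometric series. The bound is uniform in \<open>c\<close> and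
  \<open>S\<close>.\<close>

lemma sum_exp_separated_le:
  fixes x :: "int \<Rightarrow> real"
  assumes sep: "\<And>m. x m + l \<le> x (m + 1)" and l: "0 < l" and a: "0 < a" and S: "finite S"
  shows "(\<Sum>m\<in>S. exp (- a * \<bar>c - x m\<bar>)) \<le> 2 / (1 - exp (- a * l))"
proof -
  define \<rho> where "\<rho> = exp (- a * l)"
  have \<rho>: "0 \<le> \<rho>" "\<rho> < 1" using l a by (auto simp: \<rho>_def)
  have pow: "\<rho> ^ n = exp (- a * (real n * l))" for n
    unfolding \<rho>_def by (simp flip: exp_of_nat_mult add: mult_ac)
  define P where "P = {m\<in>S. c \<le> x m}"
  define M where "M = {m\<in>S. x m < c}"
  have fin: "finite P" "finite M" using S by (auto simp: P_def M_def)
  have "(\<Sum>m\<in>P. exp (- a * \<bar>c - x m\<bar>)) \<le> 1 / (1 - \<rho>)"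
  proof (rule sum_le_geometric[OF fin(1) _ \<rho>, where \<phi> = "\<lambda>m. nat (m - Min P)"])
    have ge: "Min P \<le> m" if "m \<in> P" for m using that fin by simp
    show "inj_on (\<lambda>m. nat (m - Min P)) P"
    proof (rule inj_onI)
      fix i j assume "i \<in> P" "j \<in> P" "nat (i - Min P) = nat (j - Min P)"
      then show "i = j" using ge[of i] ge[of j] by linarith
    qed
    fix m assume m: "m \<in> P"
    have "Min P \<in> P" using m fin by (intro Min_in) auto
    then have "c \<le> x (Min P)" by (simp add: P_def)
    then have "real (nat (m - Min P)) * l \<le> \<bar>c - x m\<bar>"
      using separated_growth[of x l, OF sep ge[OF m]] ge[OF m] by simp
    then show "exp (- a * \<bar>c - x m\<bar>) \<le> \<rho> ^ nat (m - Min P)"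
      unfolding pow using a by simp
  qed
  moreover have "(\<Sum>m\<in>M. exp (- a * \<bar>c - x m\<bar>)) \<le> 1 / (1 - \<rho>)"
  proof (rule sum_le_geometric[OF fin(2) _ \<rho>, where \<phi> = "\<lambda>m. nat (Max M - m)"])
    have ge: "m \<le> Max M" if "m \<in> M" for m using that fin by simp
    show "inj_on (\<lambda>m. nat (Max M - m)) M"
    proof (rule inj_onI)
      fix i j assume "i \<in> M" "j \<in> M" "nat (Max M - i) = nat (Max M - j)"
      then show "i = j" using ge[of i] ge[of j] by linarith
    qed
    fix m assume m: "m \<in> M"
    have "Max M \<in> M" using m fin by (intro Max_in) auto
    then have "x (Max M) < c" by (simp add: M_def)
    then have "real (nat (Max M - m)) * l \<le> \<bar>c - x m\<bar>"
      using separated_growth[of x l, OF sep ge[OF m]] ge[OF m] by simp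
    then show "exp (- a * \<bar>c - x m\<bar>) \<le> \<rho> ^ nat (Max M - m)"
      unfolding pow using a by simp
  qed
  moreover have "(\<Sum>m\<in>S. exp (- a * \<bar>c - x m\<bar>))
      = (\<Sum>m\<in>P. exp (- a * \<bar>c - x m\<bar>)) + (\<Sum>m\<in>M. exp (- a * \<bar>c - x m\<bar>))"
    using S by (subst sum.union_disjoint[symmetric]) (auto simp: P_def M_def intro!: sum.cong)
  ultimately show ?thesis by (simp add: \<rho>_def)
qed

text \<open>The upper bound makes \<open>\<phi>\<close> continuous, the lower bound makes it
  unbounded in both directions, and the intermediate value theorem applies.\<close>

lemma bilipschitz_surj:
  fixes \<phi> :: "real \<Rightarrow> real"
  assumes c: "0 < c" and lower: "\<And>x y. x \<le> y \<Longrightarrow> c * (y - x) \<le> \<phi> y - \<phi> x"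
    and upper: "\<And>x y. x \<le> y \<Longrightarrow> \<phi> y - \<phi> x \<le> C * (y - x)"
  shows "\<exists>x. \<phi> x = v"
proof -
  have "0 \<le> C" using lower[of 0 1] upper[of 0 1] c by simp
  have "C-lipschitz_on UNIV \<phi>"
  proof (rule lipschitz_onI)
    fix x y :: real
    show "dist (\<phi> x) (\<phi> y) \<le> C * dist x y"
    proof (cases "x \<le> y")
      case True
      then have "0 \<le> c * (y - x)" using c by simp
      then show ?thesis using lower[OF True] upper[OF True] True by (simp add: dist_real_def)
    next
      case False
      then have "0 \<le> c * (x - y)" using c by simp
      then show ?thesis using lower[of y x] upper[of y x] False by (simp add: dist_real_def)
    qed
  qed fact
  then have cont: "continuous_on UNIV \<phi>" by (rule lipschitz_on_continuous_on)
  define X where "X = \<bar>v - \<phi> 0\<bar> / c"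
  have X: "0 \<le> X" "c * X = \<bar>v - \<phi> 0\<bar>" using c by (auto simp: X_def)
  have "\<phi> (- X) \<le> v" "v \<le> \<phi> X" using lower[of "-X" 0] lower[of 0 X] X by auto
  then show ?thesis
    using IVT'[of \<phi> "-X" v X] X continuous_on_subset[OF cont] by auto
qed

text \<open>The averaged quantity \<open>h x\<close> majorizes \<open>(s powr (-\<beta>) * w s) powr \<theta>\<close> at \<open>s = exp x\<close> but varies
  slowly, so that \<open>exp (\<beta> * x) * h x powr (1/\<theta>)\<close> grows at a controlled exponential rate; the points
  \<open>x m\<close> are its level points at height \<open>2 ^ m\<close>.  The term \<open>exp (- a * \<bar>x\<bar>)\<close> keeps the majorant positive.\<close>

lemma regular_sequence:
  fixes w :: "real \<Rightarrow> real"
  assumes \<beta>: "0 < \<beta>" and \<theta>: "0 < \<theta>" and w: "mono w" "\<And>s. 0 \<le> w s" and N: "0 < N"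
    and int: "(\<integral>\<^sup>+ t\<in>{0<..}. ennreal ((t powr (-\<beta>) * w t) powr \<theta> / t) \<partial>lborel) \<le> ennreal (N powr \<theta>)"
  shows "\<exists>x::int \<Rightarrow> real. (\<forall>m. x m + 2 * ln 2 / (3 * \<beta>) \<le> x (m + 1) \<and> x (m + 1) \<le> x m + 2 * ln 2 / \<beta>
      \<and> w (exp (x m)) \<le> 2 powr \<beta> * (2 * 2 powr (\<beta> * \<theta> / 2)) powr (1/\<theta>) * 2 powr m)
    \<and> (\<forall>S. finite S \<longrightarrow> (\<Sum>m\<in>S. (2 powr m * exp (- \<beta> * x m) / N) powr \<theta>) \<le> 4 / (1 - exp (- (\<theta> * ln 2 / 3))))"
proof -
  have [measurable]: "w \<in> borel_measurable borel" using w(1) by (rule borel_measurable_mono)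
  \<comment> \<open>The rate is chosen so that \<open>a / \<theta>\<close> is half of
    \<open>\<beta>\<close>: the correction term in \<open>\<phi>\<close> below then has slope at
    most \<open>\<beta> / 2\<close>, against the main slope \<open>\<beta>\<close>.\<close>
  define a where "a = \<beta> * \<theta> / 2"
  have a: "0 < a" using \<beta> \<theta> by (simp add: a_def)
  define g where "g s = (s powr (-\<beta>) * w s) powr \<theta> / s" for s
  have g0: "0 < s \<Longrightarrow> 0 \<le> g s" for s by (simp add: g_def)
  have gm[measurable]: "g \<in> borel_measurable borel" unfolding g_def by measurable
  \<comment> \<open>In the logarithmic variable this is a convolution with a two-sided exponential,
    whose value changes by at most the factor \<open>exp (a * \<bar>y - x\<bar>)\<close> from
    \<open>x\<close> to \<open>y\<close>.\<close>
  define E where "E x = (\<integral>\<^sup>+ s\<in>{0<..}. ennreal (g s * exp (- a * \<bar>ln s - x\<bar>)) \<partial>lborel)" for x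
  define h where "h x = enn2real (E x)" for x
  have Np: "0 < N powr \<theta>" using N by simp
  have "E x \<le> (\<integral>\<^sup>+ s\<in>{0<..}. ennreal (g s) \<partial>lborel)" for x
    unfolding E_def using a g0
    by (intro nn_integral_mono) (auto simp: indicator_def intro!: ennreal_leI mult_left_le)
  then have Ele: "E x \<le> ennreal (N powr \<theta>)" for x
    using int unfolding g_def by (rule order_trans)
  then have Eh: "E x = ennreal (h x)" for x
    unfolding h_def by (metis ennreal_enn2real ennreal_less_top le_less_trans)
  have h0: "0 \<le> h x" for x by (simp add: h_def)
  have hlip: "h y \<le> exp (a * \<bar>y - x\<bar>) * h x" for x y
  proof -
    have "E y \<le> (\<integral>\<^sup>+ s. ennreal (exp (a * \<bar>y - x\<bar>)) * (ennreal (g s * exp (- a * \<bar>ln s - x\<bar>)) * indicator {0<..} s) \<partial>lborel)"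
      unfolding E_def
    proof (intro nn_integral_mono)
      fix s :: real
      have "\<bar>ln s - x\<bar> \<le> \<bar>y - x\<bar> + \<bar>ln s - y\<bar>" by linarith
      then have "- (a * \<bar>ln s - y\<bar>) \<le> a * \<bar>y - x\<bar> - a * \<bar>ln s - x\<bar>"
        using a mult_left_mono[of "\<bar>ln s - x\<bar>" "\<bar>y - x\<bar> + \<bar>ln s - y\<bar>" a] by (simp add: distrib_left)
      then have "exp (- (a * \<bar>ln s - y\<bar>)) \<le> exp (a * \<bar>y - x\<bar> - a * \<bar>ln s - x\<bar>)" by simp
      then have "exp (- a * \<bar>ln s - y\<bar>) \<le> exp (a * \<bar>y - x\<bar>) * exp (- a * \<bar>ln s - x\<bar>)"
        by (simp add: exp_diff exp_minus divide_inverse)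
      then have "g s * exp (- a * \<bar>ln s - y\<bar>) \<le> exp (a * \<bar>y - x\<bar>) * (g s * exp (- a * \<bar>ln s - x\<bar>))" if "0 < s"
        using mult_left_mono[of "exp (- a * \<bar>ln s - y\<bar>)" "exp (a * \<bar>y - x\<bar>) * exp (- a * \<bar>ln s - x\<bar>)" "g s"] g0[OF that]
        by (simp add: mult_ac)
      then show "ennreal (g s * exp (- a * \<bar>ln s - y\<bar>)) * indicator {0<..} s
         \<le> ennreal (exp (a * \<bar>y - x\<bar>)) * (ennreal (g s * exp (- a * \<bar>ln s - x\<bar>)) * indicator {0<..} s)"
        using g0 by (auto simp: indicator_def simp flip: ennreal_mult intro!: ennreal_leI)
    qed
    also have "\<dots> = ennreal (exp (a * \<bar>y - x\<bar>)) * E x"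
      unfolding E_def by (intro nn_integral_cmult) measurable
    finally show ?thesis unfolding Eh using h0 by (simp flip: ennreal_mult)
  qed
  \<comment> \<open>Only the window \<open>{e..2*e}\<close> is kept. There \<open>w s\<close> is at
    least \<open>w e\<close> by monotonicity, the kernel is at least \<open>2 powr (-a)\<close>, and
    \<open>s\<close> is at most \<open>2 * e\<close>.\<close>
  have hlow: "(2 powr (-\<beta>) * exp (- \<beta> * x) * w (exp x)) powr \<theta> \<le> 2 * 2 powr a * h x" for x
  proof -
    define e where "e = exp x"
    have e: "0 < e" "ln e = x" by (auto simp: e_def)
    define L where "L = ((2 * e) powr (-\<beta>) * w e) powr \<theta> / (2 * e) * 2 powr (-a)"
    have L0: "0 \<le> L" using e by (simp add: L_def)
    have "ennreal (L * e) = (\<integral>\<^sup>+ s. ennreal L * indicator {e..2*e} s \<partial>lborel)"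
      using e L0 by (simp add: nn_integral_cmult_indicator ennreal_mult)
    also have "\<dots> \<le> E x"
      unfolding E_def
    proof (intro nn_integral_mono)
      fix s :: real
      have "L \<le> g s * exp (- a * \<bar>ln s - x\<bar>)" if s: "e \<le> s" "s \<le> 2 * e"
      proof -
        have s0: "0 < s" using s e by simp
        have "ln s \<le> ln (2 * e)" "ln e \<le> ln s" using s s0 e by (auto simp only: ln_le_cancel_iff)
        then have "\<bar>ln s - x\<bar> \<le> ln 2" using e by (simp add: ln_mult)
        then have 1: "2 powr (-a) \<le> exp (- a * \<bar>ln s - x\<bar>)" using a by (simp add: powr_def)
        have "((2 * e) powr (-\<beta>) * w e) powr \<theta> \<le> (s powr (-\<beta>) * w s) powr \<theta>"
          using s s0 e \<beta> \<theta> w monoD[OF w(1) s(1)]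
          by (intro powr_mono2 mult_mono powr_mono2') auto
        then have "((2 * e) powr (-\<beta>) * w e) powr \<theta> / (2 * e) \<le> g s"
          unfolding g_def using s s0 by (intro frac_le) auto
        then show ?thesis unfolding L_def using 1 g0[OF s0] by (intro mult_mono) auto
      qed
      then show "ennreal L * indicator {e..2*e} s \<le> ennreal (g s * exp (- a * \<bar>ln s - x\<bar>)) * indicator {0<..} s"
        using e by (auto simp: indicator_def intro!: ennreal_leI)
    qed
    finally have "L * e \<le> h x" unfolding Eh using h0 by (simp add: ennreal_le_iff)
    moreover have "L * e = ((2 * e) powr (-\<beta>) * w e) powr \<theta> / 2 / 2 powr a"
      using e unfolding L_def by (simp add: powr_minus field_simps)
    moreover have "(2 * e) powr (-\<beta>) = 2 powr (-\<beta>) * exp (- \<beta> * x)"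
      using e by (subst powr_mult) (auto simp: e_def powr_def)
    ultimately show ?thesis unfolding e_def[symmetric] by (simp add: field_simps)
  qed
  \<comment> \<open>Dividing by \<open>N powr \<theta>\<close> makes the final sum bound independent
    of \<open>w\<close> and \<open>N\<close>.\<close>
  define G where "G x = h x / N powr \<theta> + exp (- a * \<bar>x\<bar>)" for x
  have G0: "0 < G x" for x unfolding G_def using h0[of x] Np by (intro add_nonneg_pos) auto
  have Glip: "G y \<le> exp (a * \<bar>y - x\<bar>) * G x" for x y
  proof -
    have "\<bar>x\<bar> \<le> \<bar>y - x\<bar> + \<bar>y\<bar>" by linarith
    then have "- (a * \<bar>y\<bar>) \<le> a * \<bar>y - x\<bar> - a * \<bar>x\<bar>"
      using a mult_left_mono[of "\<bar>x\<bar>" "\<bar>y - x\<bar> + \<bar>y\<bar>" a] by (simp add: distrib_left)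
    then have "exp (- (a * \<bar>y\<bar>)) \<le> exp (a * \<bar>y - x\<bar> - a * \<bar>x\<bar>)" by simp
    then have "exp (- a * \<bar>y\<bar>) \<le> exp (a * \<bar>y - x\<bar>) * exp (- a * \<bar>x\<bar>)"
      by (simp add: exp_diff exp_minus divide_inverse)
    moreover have "h y / N powr \<theta> \<le> exp (a * \<bar>y - x\<bar>) * (h x / N powr \<theta>)"
      using divide_right_mono[OF hlip[of y x], of "N powr \<theta>"] by simp
    ultimately show ?thesis unfolding G_def by (simp add: distrib_left)
  qed
  have lnG: "\<bar>ln (G y) - ln (G x)\<bar> \<le> a * \<bar>y - x\<bar>" for x y
  proof -
    have le: "ln (G y) - ln (G x) \<le> a * \<bar>y - x\<bar>" for x y
    proof -
      have "ln (G y) \<le> ln (exp (a * \<bar>y - x\<bar>) * G x)"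
        using Glip[of y x] G0[of y] G0[of x] by (subst ln_le_cancel_iff) auto
      also have "\<dots> = a * \<bar>y - x\<bar> + ln (G x)" using G0[of x] by (simp add: ln_mult)
      finally show ?thesis by simp
    qed
    show ?thesis using le[of y x] le[of x y] by (simp add: abs_le_iff abs_minus_commute)
  qed
  \<comment> \<open>The logarithm of the majorant
    \<open>N * exp (\<beta> * x) * G x powr (1/\<theta>)\<close>. Its slopes lie between
    \<open>\<beta> / 2\<close> and \<open>3 * \<beta> / 2\<close>, so an increment
    \<open>ln 2\<close> of \<open>\<phi>\<close> gives the claimed spacing of level points.\<close>
  define \<phi> where "\<phi> x = ln N + \<beta> * x + ln (G x) / \<theta>" for x
  have \<phi>lip: "\<bar>\<phi> y - \<phi> x - \<beta> * (y - x)\<bar> \<le> \<beta> / 2 * (y - x)" if "x \<le> y" for x y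
  proof -
    have "\<phi> y - \<phi> x - \<beta> * (y - x) = (ln (G y) - ln (G x)) / \<theta>"
      by (simp add: \<phi>_def diff_divide_distrib algebra_simps)
    then have "\<bar>\<phi> y - \<phi> x - \<beta> * (y - x)\<bar> = \<bar>ln (G y) - ln (G x)\<bar> / \<theta>" using \<theta> by simp
    also have "\<dots> \<le> (a * (y - x)) / \<theta>"
      using lnG[of y x] that \<theta> by (intro divide_right_mono) auto
    also have "\<dots> = \<beta> / 2 * (y - x)" using \<theta> by (simp add: a_def)
    finally show ?thesis .
  qed
  have low: "\<beta> / 2 * (y - x) \<le> \<phi> y - \<phi> x" and upp: "\<phi> y - \<phi> x \<le> 3 * \<beta> / 2 * (y - x)" if "x \<le> y" for x y
  proof -
    have "\<beta> / 2 * (y - x) + \<beta> / 2 * (y - x) = \<beta> * (y - x)" "3 * \<beta> / 2 * (y - x) = \<beta> * (y - x) + \<beta> / 2 * (y - x)"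
      by (simp_all add: field_simps)
    then show "\<beta> / 2 * (y - x) \<le> \<phi> y - \<phi> x" "\<phi> y - \<phi> x \<le> 3 * \<beta> / 2 * (y - x)"
      using \<phi>lip[OF that] by linarith+
  qed
  have "\<exists>x. \<phi> x = v" for v by (rule bilipschitz_surj[OF _ low upp]) (use \<beta> in auto)
  then have "\<exists>x. \<forall>m::int. \<phi> (x m) = of_int m * ln 2" by (intro choice) blast
  then obtain x where x: "\<And>m::int. \<phi> (x m) = of_int m * ln 2" by blast
  have step: "x m \<le> x (m + 1)" for m
  proof (rule ccontr)
    assume neg: "\<not> ?thesis"
    then have "\<beta> / 2 * (x m - x (m + 1)) \<le> \<phi> (x m) - \<phi> (x (m + 1))" by (intro low) auto
    moreover have "0 \<le> \<beta> / 2 * (x m - x (m + 1))" using \<beta> neg by (intro mult_nonneg_nonneg) auto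
    ultimately have "\<phi> (x (m + 1)) \<le> \<phi> (x m)" by linarith
    then show False by (simp add: x)
  qed
  have diff: "\<phi> (x (m + 1)) - \<phi> (x m) = ln 2" for m by (simp add: x algebra_simps)
  have s1: "x m + 2 * ln 2 / (3 * \<beta>) \<le> x (m + 1)" for m
    using upp[OF step, of m] \<beta> unfolding diff by (simp add: field_simps)
  have s2: "x (m + 1) \<le> x m + 2 * ln 2 / \<beta>" for m
    using low[OF step, of m] \<beta> unfolding diff by (simp add: field_simps)
  have two: "2 powr m = N * exp (\<beta> * x m) * G (x m) powr (1/\<theta>)" for m :: int
  proof -
    have "2 powr m = exp (\<phi> (x m))" by (simp add: x powr_def)
    also have "\<dots> = N * exp (\<beta> * x m) * G (x m) powr (1/\<theta>)"
      using N G0[of "x m"] by (simp add: \<phi>_def exp_add powr_def)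
    finally show ?thesis .
  qed
  \<comment> \<open>By the choice of the level points, the powers to be summed are exactly values of
    \<open>G\<close>.\<close>
  have z: "(2 powr m * exp (- \<beta> * x m) / N) powr \<theta> = G (x m)" for m :: int
  proof -
    have "2 powr m * exp (- \<beta> * x m) / N = G (x m) powr (1/\<theta>)"
      unfolding two using N by (simp add: exp_minus field_simps)
    then show ?thesis using \<theta> G0[of "x m"] by (simp add: powr_powr)
  qed
  have s3: "w (exp (x m)) \<le> 2 powr \<beta> * (2 * 2 powr (\<beta> * \<theta> / 2)) powr (1/\<theta>) * 2 powr m" for m
  proof -
    let ?l = "2 powr (-\<beta>) * exp (- \<beta> * x m) * w (exp (x m))"
    have "?l powr \<theta> \<le> 2 * 2 powr a * h (x m)" by (rule hlow)
    also have "\<dots> \<le> 2 * 2 powr a * (N powr \<theta> * G (x m))"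
      using Np by (intro mult_left_mono) (auto simp: G_def field_simps)
    finally have "(?l powr \<theta>) powr (1/\<theta>) \<le> (2 * 2 powr a * (N powr \<theta> * G (x m))) powr (1/\<theta>)"
      using \<theta> by (intro powr_mono2) auto
    moreover have "(?l powr \<theta>) powr (1/\<theta>) = ?l" using \<theta> w(2)[of "exp (x m)"] by (simp add: powr_powr)
    moreover have "(2 * 2 powr a * (N powr \<theta> * G (x m))) powr (1/\<theta>)
        = (2 * 2 powr a) powr (1/\<theta>) * (N * G (x m) powr (1/\<theta>))"
      using \<theta> N G0[of "x m"] by (simp add: powr_mult powr_powr)
    ultimately have "?l \<le> (2 * 2 powr a) powr (1/\<theta>) * (N * G (x m) powr (1/\<theta>))" by simp
    then have le1: "2 powr \<beta> * exp (\<beta> * x m) * ?l \<le> 2 powr \<beta> * exp (\<beta> * x m) * ((2 * 2 powr a) powr (1/\<theta>) * (N * G (x m) powr (1/\<theta>)))"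
      by (intro mult_left_mono) auto
    have eq1: "2 powr \<beta> * exp (\<beta> * x m) * ?l = w (exp (x m))"
      by (simp add: powr_minus exp_minus field_simps)
    show ?thesis using le1 unfolding eq1 two a_def[symmetric] by (simp add: mult_ac)
  qed
  \<comment> \<open>The kernel sums over the separated points are at most \<open>M\<close>,
    uniformly in the centre, so the sum may be taken under the integral. The two summands of
    \<open>G\<close> contribute \<open>M\<close> each, whence the numerator 4.\<close>
  have s4: "(\<Sum>m\<in>S. (2 powr m * exp (- \<beta> * x m) / N) powr \<theta>) \<le> 4 / (1 - exp (- (\<theta> * ln 2 / 3)))" if S: "finite S" for S
  proof -
    define M where "M = 2 / (1 - exp (- (\<theta> * ln 2 / 3)))"
    have M: "0 < M" unfolding M_def using \<theta> by simp
    have al: "a * (2 * ln 2 / (3 * \<beta>)) = \<theta> * ln 2 / 3" using \<beta> by (simp add: a_def field_simps)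
    have l0: "0 < 2 * ln 2 / (3 * \<beta>)" using \<beta> by simp
    have ex: "(\<Sum>m\<in>S. exp (- a * \<bar>c - x m\<bar>)) \<le> M" for c
      using sum_exp_separated_le[of x, OF s1 l0 a S, of c] unfolding mult_minus_left al by (simp add: M_def)
    have "ennreal (\<Sum>m\<in>S. h (x m)) = (\<Sum>m\<in>S. E (x m))"
      unfolding Eh using h0 by (simp add: sum_ennreal)
    also have "\<dots> = (\<integral>\<^sup>+ s. (\<Sum>m\<in>S. ennreal (g s * exp (- a * \<bar>ln s - x m\<bar>)) * indicator {0<..} s) \<partial>lborel)"
      unfolding E_def by (intro nn_integral_sum[symmetric]) measurable
    also have "\<dots> \<le> (\<integral>\<^sup>+ s. ennreal M * (ennreal (g s) * indicator {0<..} s) \<partial>lborel)"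
    proof (intro nn_integral_mono)
      fix s :: real
      show "(\<Sum>m\<in>S. ennreal (g s * exp (- a * \<bar>ln s - x m\<bar>)) * indicator {0<..} s) \<le> ennreal M * (ennreal (g s) * indicator {0<..} s)"
      proof (cases "0 < s")
        case True
        have "(\<Sum>m\<in>S. g s * exp (- a * \<bar>ln s - x m\<bar>)) \<le> M * g s"
          using mult_left_mono[OF ex[of "ln s"] g0[OF True]] by (simp add: sum_distrib_left mult.commute)
        then show ?thesis using True g0[OF True] M
          by (simp add: sum_ennreal ennreal_leI flip: ennreal_mult)
      qed simp
    qed
    also have "\<dots> = ennreal M * (\<integral>\<^sup>+ s\<in>{0<..}. ennreal (g s) \<partial>lborel)"
      by (intro nn_integral_cmult) measurable
    also have "\<dots> \<le> ennreal M * ennreal (N powr \<theta>)"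
      using int unfolding g_def by (intro mult_left_mono) auto
    finally have "(\<Sum>m\<in>S. h (x m)) \<le> M * N powr \<theta>"
      using M by (simp flip: ennreal_mult)
    then have "(\<Sum>m\<in>S. h (x m) / N powr \<theta>) \<le> M"
      using Np by (simp add: field_simps flip: sum_divide_distrib)
    moreover have "(\<Sum>m\<in>S. exp (- a * \<bar>x m\<bar>)) \<le> M" using ex[of 0] by simp
    moreover have "M + M = 4 / (1 - exp (- (\<theta> * ln 2 / 3)))" by (simp add: M_def)
    ultimately show ?thesis unfolding z G_def sum.distrib by linarith
  qed
  show ?thesis using s1 s2 s3 s4 by blast
qed

section \<open>From Besov seminorms to level points\<close>

lemma enn_powr_le_imp:
  assumes "enn_powr I (1/r) \<le> ennreal N" "0 < r" "0 \<le> N"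
  shows "I \<le> ennreal (N powr r)"
proof -
  have fin: "I \<noteq> \<infinity>" using assms(1) by (auto simp: enn_powr_def top_unique)
  then have "enn2real I powr (1/r) \<le> N" using assms by (simp add: enn_powr_def)
  then have "(enn2real I powr (1/r)) powr r \<le> N powr r" using assms by (intro powr_mono2) auto
  then have "enn2real I \<le> N powr r" using assms by (simp add: powr_powr)
  then have "ennreal (enn2real I) \<le> ennreal (N powr r)" by (rule ennreal_leI)
  then show ?thesis using fin by (metis ennreal_enn2real infinity_ennreal_def less_top)
qed

lemma enn_powr_mono_le:
  assumes "I \<le> ennreal (N powr r)" "0 < r" "0 \<le> N"
  shows "enn_powr I (1/r) \<le> ennreal N"
proof -
  have fin: "I < top" using assms(1) by (rule le_less_trans) simp
  then have "enn2real I \<le> N powr r" using assms(1) by (intro enn2real_leI) auto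
  then have "enn2real I powr (1/r) \<le> (N powr r) powr (1/r)" using assms by (intro powr_mono2) auto
  then show ?thesis using assms fin by (auto simp: enn_powr_def powr_powr ennreal_leI)
qed

text \<open>For infinite \<open>\<theta>\<close> the bound is 1 and not \<open>D\<close>, so that
  the corresponding factors can simply be dropped from a product. In the other case, bounding all
  finite partial sums expresses summability over the integers.\<close>

definition weighted_bounded :: "ereal \<Rightarrow> real \<Rightarrow> (int \<Rightarrow> real) \<Rightarrow> bool" where
  "weighted_bounded \<theta> D z \<longleftrightarrow>
     (if \<theta> = \<infinity> then \<forall>m. z m \<le> 1
      else \<forall>S. finite S \<longrightarrow> (\<Sum>m\<in>S. z m powr real_of_ereal \<theta>) \<le> D)"

lemma besov_regular_sequence:
  fixes \<beta> :: real and \<theta> :: ereal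
  assumes \<beta>: "0 < \<beta>" and \<theta>: "0 < \<theta>"
  obtains C D where "0 < C" "0 < D"
    "\<And>(f::real^'n \<Rightarrow> real) p k N. in_Lp f p \<Longrightarrow> 0 < p \<Longrightarrow> 0 < N \<Longrightarrow> besov_seminorm f \<beta> p \<theta> k \<le> ennreal N \<Longrightarrow>
      \<exists>x::int \<Rightarrow> real. (\<forall>m. x m + 2 * ln 2 / (3 * \<beta>) \<le> x (m + 1) \<and> x (m + 1) \<le> x m + 2 * ln 2 / \<beta>
        \<and> part_modulus f k (exp (x m)) p \<le> C * 2 powr m)
      \<and> weighted_bounded \<theta> D (\<lambda>m. 2 powr m * exp (- \<beta> * x m) / N)"
proof (cases "\<theta> = \<infinity>")
  case True
  show thesis
  proof (rule that[of 1 1])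
    fix f :: "real^'n \<Rightarrow> real" and p k N
    assume f: "in_Lp f p" "0 < p" "0 < N" and le: "besov_seminorm f \<beta> p \<theta> k \<le> ennreal N"
    \<comment> \<open>The solution of \<open>N * exp (\<beta> * x m) = 2 powr m\<close>, for which
      the weighted value is exactly 1.\<close>
    define x where "x m = (of_int m * ln 2 - ln N) / \<beta>" for m :: int
    have ex: "exp (\<beta> * x m) = 2 powr m / N" for m
      using \<beta> f(3) by (simp add: x_def exp_diff powr_def)
    have "part_modulus f k (exp (x m)) p \<le> 1 * 2 powr m" for m
    proof -
      have "ennreal (exp (x m) powr (-\<beta>) * part_modulus f k (exp (x m)) p) \<le> besov_seminorm f \<beta> p \<theta> k"
        using True unfolding besov_seminorm_def by (auto intro!: SUP_upper2[of "exp (x m)"])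
      also note le
      finally have "exp (x m) powr (-\<beta>) * part_modulus f k (exp (x m)) p \<le> N"
        using f(3) by (simp add: ennreal_le_iff)
      moreover have "exp (x m) powr (-\<beta>) = N / 2 powr m"
        using ex[of m] f(3) by (simp add: powr_def exp_minus)
      ultimately show ?thesis using f(3) by (simp add: field_simps)
    qed
    moreover have "x m + 2 * ln 2 / (3 * \<beta>) \<le> x (m + 1)" "x (m + 1) \<le> x m + 2 * ln 2 / \<beta>" for m
      using \<beta> by (auto simp: x_def field_simps)
    moreover have "weighted_bounded \<theta> 1 (\<lambda>m. 2 powr m * exp (- \<beta> * x m) / N)"
      using True ex f(3) by (simp add: weighted_bounded_def exp_minus)
    ultimately show "\<exists>x::int \<Rightarrow> real. (\<forall>m. x m + 2 * ln 2 / (3 * \<beta>) \<le> x (m + 1) \<and> x (m + 1) \<le> x m + 2 * ln 2 / \<beta>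
        \<and> part_modulus f k (exp (x m)) p \<le> 1 * 2 powr m)
      \<and> weighted_bounded \<theta> 1 (\<lambda>m. 2 powr m * exp (- \<beta> * x m) / N)" by blast
  qed auto
next
  case False
  then obtain r where r: "\<theta> = ereal r" "0 < r" using \<theta> by (cases \<theta>) auto
  define C where "C = 2 powr \<beta> * (2 * 2 powr (\<beta> * r / 2)) powr (1/r)"
  define D where "D = 4 / (1 - exp (- (r * ln 2 / 3)))"
  show thesis
  proof (rule that[of C D])
    show "0 < C" by (simp add: C_def)
    show "0 < D" using r(2) by (simp add: D_def)
    fix f :: "real^'n \<Rightarrow> real" and p k N
    assume f: "in_Lp f p" "0 < p" "0 < N" and le: "besov_seminorm f \<beta> p \<theta> k \<le> ennreal N"
    \<comment> \<open>For negative \<open>s\<close> the modulus is the supremum of an empty set; the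
      value 0 there makes \<open>w\<close> monotone and nonnegative on the whole line.\<close>
    define w where "w s = (if 0 < s then part_modulus f k s p else 0)" for s
    have w0: "0 \<le> w s" for s using part_modulus_nonneg[OF f(1,2), of s k] by (simp add: w_def)
    have wm: "mono w"
    proof (rule monoI)
      fix s t :: real assume "s \<le> t"
      then show "w s \<le> w t"
        using part_modulus_mono[OF f(1,2), of s t k] w0[of t] by (cases "0 < s") (auto simp: w_def)
    qed
    have "(\<integral>\<^sup>+ t\<in>{0<..}. ennreal ((t powr (-\<beta>) * w t) powr r / t) \<partial>lborel)
      = (\<integral>\<^sup>+ t\<in>{0<..}. ennreal ((t powr (-\<beta>) * part_modulus f k t p) powr r / t) \<partial>lborel)"
      by (intro nn_integral_cong) (auto simp: indicator_def w_def)
    also have "\<dots> \<le> ennreal (N powr r)"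
      using le r f(3) by (intro enn_powr_le_imp) (auto simp: besov_seminorm_def)
    finally have "\<exists>x::int \<Rightarrow> real. (\<forall>m. x m + 2 * ln 2 / (3 * \<beta>) \<le> x (m + 1) \<and> x (m + 1) \<le> x m + 2 * ln 2 / \<beta>
        \<and> w (exp (x m)) \<le> C * 2 powr m)
      \<and> (\<forall>S. finite S \<longrightarrow> (\<Sum>m\<in>S. (2 powr m * exp (- \<beta> * x m) / N) powr r) \<le> D)"
      unfolding C_def D_def by (rule regular_sequence[OF \<beta> r(2) wm w0 f(3)])
    then show "\<exists>x::int \<Rightarrow> real. (\<forall>m. x m + 2 * ln 2 / (3 * \<beta>) \<le> x (m + 1) \<and> x (m + 1) \<le> x m + 2 * ln 2 / \<beta>
        \<and> part_modulus f k (exp (x m)) p \<le> C * 2 powr m)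
      \<and> weighted_bounded \<theta> D (\<lambda>m. 2 powr m * exp (- \<beta> * x m) / N)"
      using r by (simp add: weighted_bounded_def w_def)
  qed
qed

section \<open>Discrete recursions\<close>

text \<open>Convexity is applied to positive arguments; if one of them vanishes, the claim reduces
  to \<open>a powr \<theta> \<le> a\<close> for \<open>a\<close> in the unit interval.\<close>

lemma powr_convex_comb:
  fixes y z r \<theta> :: real
  assumes "0 \<le> y" "0 \<le> z" "0 \<le> r" "r \<le> 1" "1 \<le> \<theta>"
  shows "(r * y + (1 - r) * z) powr \<theta> \<le> r * y powr \<theta> + (1 - r) * z powr \<theta>"
proof -
  have scale: "(a * v) powr \<theta> \<le> a * v powr \<theta>" if "0 \<le> a" "a \<le> 1" "0 \<le> v" for a v :: real
  proof -
    have "a powr \<theta> \<le> a" using powr_mono'[of 1 \<theta> a] that assms(5) by simp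
    then show ?thesis using that by (simp add: powr_mult mult_right_mono)
  qed
  show ?thesis
  proof (cases "y = 0 \<or> z = 0")
    case True
    then show ?thesis using scale[of r y] scale[of "1 - r" z] assms by auto
  next
    case False
    from convex_onD[OF powr_convex[OF assms(5)], of "1 - r" y z] False show ?thesis using assms by simp
  qed
qed

text \<open>After convexity, summing over an interval puts almost the same sum on both sides, and
  \<open>r < 1\<close> allows absorbing it. The boundary term left at the right end vanishes by
  \<open>lim\<close>; without decay, \<open>y m = r powr (- m)\<close> would satisfy the recursion
  with zero forcing for \<open>0 < r\<close>.\<close>

lemma recursive_sum_bound:
  fixes y X :: "int \<Rightarrow> real"
  assumes r: "0 \<le> r" "r < 1" and \<theta>: "1 \<le> \<theta>"
    and y: "\<And>m. 0 \<le> y m" and X: "\<And>m. 0 \<le> X m"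
    and rec: "\<And>m. y m \<le> r * y (m + 1) + K * X m" and K: "0 \<le> K"
    and lim: "(\<lambda>n. y (int n)) \<longlonglongrightarrow> 0"
    and B: "\<And>S. finite S \<Longrightarrow> (\<Sum>m\<in>S. X m powr \<theta>) \<le> B" and S: "finite S"
  shows "(\<Sum>m\<in>S. y m powr \<theta>) \<le> (K / (1 - r)) powr \<theta> * B"
proof -
  define L where "L = (K / (1 - r)) powr \<theta>"
  have rec': "y m powr \<theta> \<le> r * y (m + 1) powr \<theta> + (1 - r) * (L * X m powr \<theta>)" for m
  proof -
    \<comment> \<open>The forcing term is written as \<open>1 - r\<close> times
      \<open>K / (1 - r) * X m\<close>, which makes the right side a convex combination.\<close>
    have "y m powr \<theta> \<le> (r * y (m + 1) + (1 - r) * (K / (1 - r) * X m)) powr \<theta>"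
      using rec[of m] y[of m] r \<theta> by (intro powr_mono2) auto
    also have "\<dots> \<le> r * y (m + 1) powr \<theta> + (1 - r) * (K / (1 - r) * X m) powr \<theta>"
      using y X K r \<theta> by (intro powr_convex_comb) auto
    also have "(K / (1 - r) * X m) powr \<theta> = L * X m powr \<theta>"
      using K r X[of m] by (simp add: L_def powr_mult powr_divide)
    finally show ?thesis .
  qed
  have part: "(\<Sum>m\<in>{a..<a + int n}. y m powr \<theta>) \<le> L * B + r / (1 - r) * y (a + int n) powr \<theta>" for a n
  proof -
    let ?T = "{a..<a + int n}"
    define \<Sigma> where "\<Sigma> = (\<Sum>m\<in>?T. y m powr \<theta>)"
    have sh: "(\<Sum>m\<in>?T. y (m + 1) powr \<theta>) \<le> \<Sigma> + y (a + int n) powr \<theta>"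
    proof -
      have "(\<Sum>m\<in>?T. y (m + 1) powr \<theta>) = (\<Sum>m\<in>(\<lambda>m. m + 1) ` ?T. y m powr \<theta>)"
        by (subst sum.reindex) (auto simp: inj_on_def)
      also have "\<dots> \<le> (\<Sum>m\<in>insert (a + int n) ?T. y m powr \<theta>)"
        by (intro sum_mono2) auto
      also have "\<dots> = \<Sigma> + y (a + int n) powr \<theta>" by (simp add: \<Sigma>_def)
      finally show ?thesis .
    qed
    have "\<Sigma> \<le> (\<Sum>m\<in>?T. r * y (m + 1) powr \<theta> + (1 - r) * (L * X m powr \<theta>))"
      unfolding \<Sigma>_def by (intro sum_mono rec')
    also have "\<dots> = r * (\<Sum>m\<in>?T. y (m + 1) powr \<theta>) + (1 - r) * (L * (\<Sum>m\<in>?T. X m powr \<theta>))"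
      by (simp add: sum.distrib sum_distrib_left)
    also have "\<dots> \<le> r * (\<Sigma> + y (a + int n) powr \<theta>) + (1 - r) * (L * B)"
      using sh B[of ?T] r by (intro add_mono mult_left_mono) (auto simp: L_def)
    finally have "(1 - r) * \<Sigma> \<le> r * y (a + int n) powr \<theta> + (1 - r) * (L * B)"
      by (simp add: algebra_simps)
    then have "\<Sigma> \<le> (r * y (a + int n) powr \<theta> + (1 - r) * (L * B)) / (1 - r)"
      using r by (simp add: field_simps)
    also have "\<dots> = L * B + r / (1 - r) * y (a + int n) powr \<theta>" using r by (simp add: add_divide_distrib)
    finally show ?thesis by (simp add: \<Sigma>_def)
  qed
  obtain b where b: "\<And>m. m \<in> S \<Longrightarrow> \<bar>m\<bar> \<le> b" "0 \<le> b"
  proof (cases "S = {}")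
    case False
    show ?thesis
    proof (rule that[of "Max (abs ` S)"])
      show "\<bar>m\<bar> \<le> Max (abs ` S)" if "m \<in> S" for m using that S by auto
      then show "0 \<le> Max (abs ` S)" using False by (meson abs_ge_zero all_not_in_conv order_trans)
    qed
  qed (auto intro: that[of 0])
  have le: "(\<Sum>m\<in>S. y m powr \<theta>) \<le> L * B + r / (1 - r) * y (int n) powr \<theta>" if n: "nat b + 1 \<le> n" for n
  proof -
    \<comment> \<open>The interval starts at \<open>- b\<close> and ends just before
      \<open>int n\<close>, so it contains \<open>S\<close> and its boundary value is
      \<open>y (int n)\<close>.\<close>
    have "(\<Sum>m\<in>S. y m powr \<theta>) \<le> (\<Sum>m\<in>{-b..<-b + int (n + nat b)}. y m powr \<theta>)"
      using b n by (intro sum_mono2) (force simp: abs_le_iff)+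
    also have "\<dots> \<le> L * B + r / (1 - r) * y (-b + int (n + nat b)) powr \<theta>" by (rule part)
    also have "-b + int (n + nat b) = int n" using b by simp
    finally show ?thesis .
  qed
  have "(\<lambda>n. L * B + r / (1 - r) * y (int n) powr \<theta>) \<longlonglongrightarrow> L * B + r / (1 - r) * 0 powr \<theta>"
    using \<theta> y by (intro tendsto_intros tendsto_powr' lim) auto
  then have "(\<lambda>n. L * B + r / (1 - r) * y (int n) powr \<theta>) \<longlonglongrightarrow> L * B" by simp
  then show ?thesis
    unfolding L_def[symmetric] by (rule LIMSEQ_le_const) (use le in blast)
qed

text \<open>\<open>L / (1 - r)\<close> is the fixed point of \<open>v \<mapsto> r * v + L\<close>.
  Iterating carries the bound from \<open>m\<close> to indices so far to the right that
  \<open>y\<close> is negligible.\<close>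

lemma recursive_sup_bound:
  fixes y :: "int \<Rightarrow> real"
  assumes r: "0 \<le> r" "r < 1" and y: "\<And>m. 0 \<le> y m"
    and rec: "\<And>m. y m \<le> r * y (m + 1) + L"
    and lim: "(\<lambda>n. y (int n)) \<longlonglongrightarrow> 0"
  shows "y m \<le> L / (1 - r)"
proof -
  have it: "y m \<le> y (m + int n) + L / (1 - r)" for m n
  proof (induction n arbitrary: m)
    case 0
    \<comment> \<open>A negative \<open>L\<close> would keep \<open>y\<close> above the positive
      number \<open>- L\<close> at every index, against its decay.\<close>
    have "0 \<le> L"
    proof (rule ccontr)
      assume "\<not> 0 \<le> L"
      have "r * y (m + 1) \<le> y (m + 1)" for m using r y[of "m+1"] by (simp add: mult_left_le_one_le)
      then have "- L \<le> y (m + 1)" for m using rec[of m] y[of m] by (smt (verit))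
      from this[of "int n - 1" for n] have "- L \<le> y (int n)" for n by simp
      then have "- L \<le> 0" by (intro LIMSEQ_le_const[OF lim]) auto
      then show False using \<open>\<not> 0 \<le> L\<close> by simp
    qed
    then show ?case using r by simp
  next
    case (Suc n)
    have "y m \<le> r * y (m + 1) + L" by (rule rec)
    also have "\<dots> \<le> r * (y (m + 1 + int n) + L / (1 - r)) + L"
      using Suc.IH[of "m+1"] r by (intro add_right_mono mult_left_mono) auto
    also have "\<dots> = r * y (m + 1 + int n) + L / (1 - r)" using r by (simp add: field_simps)
    also have "\<dots> \<le> y (m + 1 + int n) + L / (1 - r)"
      using r y[of "m + 1 + int n"] by (simp add: mult_left_le_one_le)
    finally show ?case by (simp add: add_ac)
  qed
  have "(\<lambda>n. y (int n) + L / (1 - r)) \<longlonglongrightarrow> 0 + L / (1 - r)" by (intro tendsto_intros lim)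
  then have lim': "(\<lambda>n. y (int n) + L / (1 - r)) \<longlonglongrightarrow> L / (1 - r)" by simp
  have "y m \<le> y (int k) + L / (1 - r)" if "nat m \<le> k" for k
    using it[of m "nat (int k - m)"] that by (simp split: if_splits)
  then show ?thesis by (intro LIMSEQ_le_const[OF lim']) blast
qed

section \<open>Discretization of the Lorentz norm\<close>

text \<open>The sequence is unbounded in both directions. Starting from an index whose point lies
  below \<open>c\<close>, the first index reaching \<open>c\<close> and its predecessor bracket
  \<open>c\<close>.\<close>

lemma separated_cover:
  fixes x :: "int \<Rightarrow> real"
  assumes sep: "\<And>m. x m + l \<le> x (m + 1)" and l: "0 < l"
  shows "\<exists>m. x m < c \<and> c \<le> x (m + 1)"
proof -
  obtain a :: nat where a: "x 0 - c < real a * l" using reals_Archimedean3[OF l] by blast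
  have lo: "x (- int a) < c" using separated_growth[of x l "- int a" 0, OF sep] a by simp
  obtain b :: nat where b: "c - x (- int a) < real b * l" using reals_Archimedean3[OF l] by blast
  have hi: "c \<le> x (- int a + int b)" using separated_growth[of x l "- int a" "- int a + int b", OF sep] b by simp
  define k where "k = (LEAST k. c \<le> x (- int a + int k))"
  have k: "c \<le> x (- int a + int k)" unfolding k_def using hi by (rule LeastI)
  then have "k \<noteq> 0" using lo by (intro notI) simp
  then obtain k' where k': "k = Suc k'" by (cases k) auto
  have "\<not> c \<le> x (- int a + int k')" using not_less_Least[of k' "\<lambda>k. c \<le> x (- int a + int k)"] k' by (simp add: k_def)
  then show ?thesis using k k' by (intro exI[of _ "- int a + int k'"]) (simp add: add_ac)
qed

text \<open>The power of \<open>t\<close> is estimated at the right endpoint and the decreasing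
  rearrangement at the left one; the mismatch costs \<open>exp ((b - a) / q)\<close>.\<close>

lemma rearr_between:
  assumes f: "in_Lp f p" "0 < p" and q: "0 < q" and t: "exp a < t" "t \<le> exp b"
  shows "t powr (1/q) * rearr f t \<le> exp ((b - a) / q) * (exp (a / q) * rearr f (exp a))"
proof -
  have "t powr (1/q) * rearr f t \<le> (exp b) powr (1/q) * rearr f (exp a)"
    using f q t rearr_nonneg[OF f, of t] rearr_antimono[OF f, of "exp a" t]
      less_trans[OF exp_gt_zero t(1)]
    by (intro mult_mono powr_mono2) auto
  also have "(exp b) powr (1/q) = exp ((b - a) / q) * exp (a / q)"
    by (simp add: powr_def flip: exp_add) (simp add: diff_divide_distrib)
  finally show ?thesis by (simp add: mult_ac)
qed

lemma lorentz_norm_le_discrete_sup: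
  fixes X :: "int \<Rightarrow> real"
  assumes f: "in_Lp f p" "0 < p" and q: "0 < q" and l: "0 < l"
    and sep: "\<And>m. X m + l \<le> X (m + 1)" and upp: "\<And>m. X (m + 1) \<le> X m + L"
    and B: "\<And>m. exp (X m / q) * rearr f (exp (X m)) \<le> B"
  shows "lorentz_norm f q \<infinity> \<le> ennreal (exp (L / q) * B)"
proof -
  have "t powr (1/q) * rearr f t \<le> exp (L / q) * B" if t: "0 < t" for t
  proof -
    obtain m where m: "X m < ln t" "ln t \<le> X (m + 1)" using separated_cover[of X, OF sep l] by blast
    have "exp (X m) < exp (ln t)" "exp (ln t) \<le> exp (X (m + 1))" using m by auto
    then have "t powr (1/q) * rearr f t \<le> exp ((X (m + 1) - X m) / q) * (exp (X m / q) * rearr f (exp (X m)))"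
      using t by (intro rearr_between[OF f q]) auto
    also have "\<dots> \<le> exp (L / q) * B"
      using upp[of m] B[of m] q rearr_nonneg[OF f, of "exp (X m)"]
      by (intro mult_mono) (auto intro!: divide_right_mono)
    finally show ?thesis .
  qed
  then show ?thesis unfolding lorentz_norm_def by (auto intro!: SUP_least ennreal_leI)
qed

text \<open>The half-line is cut into blocks between consecutive points \<open>exp (X m)\<close>.
  Each block has measure at most \<open>exp L - 1\<close> with respect to \<open>dt / t\<close>,
  even with \<open>1 / t\<close> replaced by its value at the left endpoint.\<close>

lemma lorentz_norm_le_discrete_sum:
  fixes X :: "int \<Rightarrow> real"
  assumes f: "in_Lp f p" "0 < p" and q: "0 < q" and l: "0 < l" and \<theta>: "0 < \<theta>"
    and sep: "\<And>m. X m + l \<le> X (m + 1)" and upp: "\<And>m. X (m + 1) \<le> X m + L"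
    and B: "\<And>S. finite S \<Longrightarrow> (\<Sum>m\<in>S. (exp (X m / q) * rearr f (exp (X m))) powr \<theta>) \<le> B powr \<theta>"
    and B0: "0 \<le> B"
  shows "lorentz_norm f q (ereal \<theta>) \<le> ennreal (exp (L / q) * (exp L - 1) powr (1/\<theta>) * B)"
proof -
  define y where "y m = exp (X m / q) * rearr f (exp (X m))" for m
  have y0: "0 \<le> y m" for m using rearr_nonneg[OF f, of "exp (X m)"] by (simp add: y_def)
  have L: "0 < L" using sep[of 0] upp[of 0] l by simp
  define c where "c m = (exp (L / q) * y m) powr \<theta> / exp (X m)" for m
  have c0: "0 \<le> c m" for m by (simp add: c_def)
  define A where "A = exp (L / q) powr \<theta> * (exp L - 1)"
  have A0: "0 \<le> A" using L by (simp add: A_def)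
  \<comment> \<open>The blocks are indexed by integers; \<open>int_decode\<close> enumerates them so
    that the total becomes an ordinary series.\<close>
  let ?I = "\<lambda>m. {exp (X m)<..exp (X (m + 1))}"
  have "(\<integral>\<^sup>+ t\<in>{0<..}. ennreal ((t powr (1/q) * rearr f t) powr \<theta> / t) \<partial>lborel)
     \<le> (\<integral>\<^sup>+ t. (\<Sum>i. ennreal (c (int_decode i)) * indicator (?I (int_decode i)) t) \<partial>lborel)"
  proof (intro nn_integral_mono)
    fix t :: real
    show "ennreal ((t powr (1/q) * rearr f t) powr \<theta> / t) * indicator {0<..} t
       \<le> (\<Sum>i. ennreal (c (int_decode i)) * indicator (?I (int_decode i)) t)"
    proof (cases "0 < t")
      case t: True
      obtain m where m: "X m < ln t" "ln t \<le> X (m + 1)" using separated_cover[of X, OF sep l] by blast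
      have "exp (X m) < exp (ln t)" "exp (ln t) \<le> exp (X (m + 1))" using m by auto
      then have I: "exp (X m) < t" "t \<le> exp (X (m + 1))" using t by auto
      have "t powr (1/q) * rearr f t \<le> exp ((X (m + 1) - X m) / q) * y m"
        unfolding y_def by (rule rearr_between[OF f q I])
      also have "\<dots> \<le> exp (L / q) * y m"
        using upp[of m] q y0[of m] by (intro mult_right_mono) (auto intro!: divide_right_mono)
      finally have "(t powr (1/q) * rearr f t) powr \<theta> \<le> (exp (L / q) * y m) powr \<theta>"
        using rearr_nonneg[OF f t] \<theta> by (intro powr_mono2) auto
      then have "(t powr (1/q) * rearr f t) powr \<theta> / t \<le> c m"
        unfolding c_def using I by (intro frac_le) auto
      then have "ennreal ((t powr (1/q) * rearr f t) powr \<theta> / t) * indicator {0<..} t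
          \<le> ennreal (c (int_decode (int_encode m))) * indicator (?I (int_decode (int_encode m))) t"
        using t I by (simp add: ennreal_leI)
      also have "\<dots> = (\<Sum>i\<in>{int_encode m}. ennreal (c (int_decode i)) * indicator (?I (int_decode i)) t)" by simp
      also have "\<dots> \<le> (\<Sum>i. ennreal (c (int_decode i)) * indicator (?I (int_decode i)) t)"
        by (intro sum_le_suminf summableI) auto
      finally show ?thesis .
    qed simp
  qed
  also have "\<dots> = (\<Sum>i. \<integral>\<^sup>+ t. ennreal (c (int_decode i)) * indicator (?I (int_decode i)) t \<partial>lborel)"
    by (intro nn_integral_suminf) measurable
  also have "\<dots> \<le> (\<Sum>i. ennreal (A * y (int_decode i) powr \<theta>))"
  proof (intro suminf_le summableI)
    fix i
    define m where "m = int_decode i"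
    have le: "X m \<le> X (m + 1)" using sep[of m] l by simp
    have "(\<integral>\<^sup>+ t. ennreal (c m) * indicator (?I m) t \<partial>lborel) = ennreal (c m * (exp (X (m + 1)) - exp (X m)))"
      using le c0[of m] by (simp add: nn_integral_cmult_indicator ennreal_mult)
    also have "\<dots> \<le> ennreal (A * y m powr \<theta>)"
    proof (intro ennreal_leI)
      have "exp (X (m + 1)) \<le> exp (X m + L)" using upp[of m] by simp
      then have "exp (X (m + 1)) - exp (X m) \<le> exp (X m) * (exp L - 1)" by (simp add: exp_add algebra_simps)
      then have "c m * (exp (X (m + 1)) - exp (X m)) \<le> c m * (exp (X m) * (exp L - 1))"
        using c0[of m] by (intro mult_left_mono)
      also have "\<dots> = A * y m powr \<theta>"
        using y0[of m] by (simp add: c_def A_def powr_mult)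
      finally show "c m * (exp (X (m + 1)) - exp (X m)) \<le> A * y m powr \<theta>" .
    qed
    finally show "(\<integral>\<^sup>+ t. ennreal (c (int_decode i)) * indicator (?I (int_decode i)) t \<partial>lborel)
       \<le> ennreal (A * y (int_decode i) powr \<theta>)" by (simp add: m_def)
  qed
  also have "\<dots> \<le> ennreal (A * B powr \<theta>)"
  proof (rule suminf_le_const[OF summableI])
    fix n
    have "(\<Sum>i<n. ennreal (A * y (int_decode i) powr \<theta>)) = ennreal (A * (\<Sum>i<n. y (int_decode i) powr \<theta>))"
      using A0 by (simp add: sum_ennreal sum_distrib_left)
    also have "(\<Sum>i<n. y (int_decode i) powr \<theta>) = (\<Sum>m\<in>int_decode ` {..<n}. y m powr \<theta>)"
      by (simp add: sum.reindex inj_int_decode)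
    also have "ennreal (A * \<dots>) \<le> ennreal (A * B powr \<theta>)"
      using B[of "int_decode ` {..<n}"] A0 by (intro ennreal_leI mult_left_mono) (auto simp: y_def)
    finally show "(\<Sum>i<n. ennreal (A * y (int_decode i) powr \<theta>)) \<le> ennreal (A * B powr \<theta>)" .
  qed
  also have "A * B powr \<theta> = (exp (L / q) * (exp L - 1) powr (1/\<theta>) * B) powr \<theta>"
    using L \<theta> B0 by (simp add: A_def powr_mult powr_powr)
  finally show ?thesis
    unfolding lorentz_norm_def using \<theta> B0 by (auto intro!: enn_powr_mono_le)
qed

text \<open>Jensen's inequality for \<open>exp\<close> at the points
  \<open>ln (a j)\<close>.\<close>

lemma weighted_AM_GM:
  fixes a \<tau> :: "'i \<Rightarrow> real"
  assumes "finite J" "\<And>j. j \<in> J \<Longrightarrow> 0 < a j" "\<And>j. j \<in> J \<Longrightarrow> 0 \<le> \<tau> j" "(\<Sum>j\<in>J. \<tau> j) = 1"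
  shows "(\<Prod>j\<in>J. a j powr \<tau> j) \<le> (\<Sum>j\<in>J. \<tau> j * a j)"
proof -
  have "J \<noteq> {}" using assms(4) by auto
  have "(\<Prod>j\<in>J. a j powr \<tau> j) = exp (\<Sum>j\<in>J. \<tau> j * ln (a j))"
  proof -
    have "a j powr \<tau> j = exp (\<tau> j * ln (a j))" if "j \<in> J" for j using assms(2)[OF that] by (simp add: powr_def)
    then show ?thesis by (simp add: exp_sum assms(1))
  qed
  also have "\<dots> \<le> (\<Sum>j\<in>J. \<tau> j * exp (ln (a j)))"
    using convex_on_sum[OF assms(1) \<open>J \<noteq> {}\<close> exp_convex assms(4,3), of "\<lambda>j. ln (a j)"] by simp
  also have "\<dots> = (\<Sum>j\<in>J. \<tau> j * a j)" using assms(2) by (intro sum.cong) auto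
  finally show ?thesis .
qed

section \<open>The embedding\<close>

lemma divide_exp_powr:
  fixes a x s :: real
  assumes "0 \<le> a"
  shows "(a / exp x) powr s = a powr s * exp (- x * s)"
proof -
  have "(a / exp x) powr s = a powr s / exp x powr s" using assms by (simp add: powr_divide)
  also have "exp x powr s = exp (x * s)" by (simp add: powr_def mult.commute)
  finally show ?thesis by (simp add: exp_minus divide_inverse)
qed

text \<open>\<open>rearr_diff_le\<close> is applied at \<open>exp (X m)\<close> with box sides
  \<open>exp (x j (m + 1))\<close>, whose product is \<open>exp (X (m + 1))\<close>. The separation
  yields the contraction \<open>exp (- l / q)\<close>, the exponents \<open>1 / q\<close> and
  \<open>- 1 / p\<close> combine to \<open>- b\<close>, and the extra factor 2 comes from
  \<open>2 powr (m + 1)\<close>.\<close>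

lemma discrete_recursion:
  fixes f :: "real^'n \<Rightarrow> real" and x :: "'n \<Rightarrow> int \<Rightarrow> real"
  defines "X \<equiv> \<lambda>m. \<Sum>j\<in>UNIV. x j m"
  defines "y \<equiv> \<lambda>q m. exp (X m / q) * rearr f (exp (X m))"
  assumes f: "in_Lp f p" and p: "1 \<le> p" and q: "0 < q" "1 / q = 1 / p - b"
    and sep: "\<And>m. X m + l \<le> X (m + 1)"
    and mod: "\<And>j m. part_modulus f j (exp (x j m)) p \<le> C * 2 powr m"
  shows "y q m \<le> exp (- l / q) * y q (m + 1)
    + (2 * (4 powr p) ^ CARD('n)) powr (1/p) * 2 * C * (2 powr m * exp (- b * X m))"
proof -
  have p0: "0 < p" using p by simp
  define K where "K = (2 * (4 powr p) ^ CARD('n)) powr (1/p)"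
  have prod: "(\<Prod>j\<in>UNIV. exp (x j m)) = exp (X m)" for m by (simp add: X_def exp_sum)
  have "rearr f (exp (X m)) \<le> rearr f (exp (X (m + 1)))
      + (2 * (4 powr p) ^ CARD('n) / exp (X m)) powr (1/p) * (C * 2 powr (m + 1))"
    using rearr_diff_le[OF f p, of "\<lambda>j. exp (x j (m + 1))" "C * 2 powr (m + 1)" "exp (X m)"] mod[of _ "m + 1"]
    by (simp add: prod)
  also have "(2 * (4 powr p) ^ CARD('n) / exp (X m)) powr (1/p) = K * exp (- X m / p)"
    using divide_exp_powr[of "2 * (4 powr p) ^ CARD('n)" "X m" "1/p"] by (simp add: K_def)
  finally have "y q m \<le> exp (X m / q) * (rearr f (exp (X (m + 1))) + K * exp (- X m / p) * (C * 2 powr (m + 1)))"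
    unfolding y_def by (intro mult_left_mono) auto
  also have "\<dots> = exp (X m / q) * rearr f (exp (X (m + 1))) + K * 2 * C * (2 powr m * (exp (X m / q) * exp (- X m / p)))"
    by (simp add: algebra_simps powr_add)
  also have "exp (X m / q) * exp (- X m / p) = exp (- b * X m)"
  proof -
    have "X m / q = X m * (1 / q)" by simp
    then have "X m / q + - X m / p = - b * X m" unfolding q(2) by (simp add: algebra_simps)
    then show ?thesis by (metis exp_add)
  qed
  also have "exp (X m / q) * rearr f (exp (X (m + 1))) \<le> exp (- l / q) * y q (m + 1)"
  proof -
    have "X m / q \<le> - l / q + X (m + 1) / q"
      using divide_right_mono[OF sep[of m], of q] q(1) by (simp add: add_divide_distrib)
    then have "exp (X m / q) \<le> exp (- l / q) * exp (X (m + 1) / q)" by (simp flip: exp_add)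
    then show ?thesis unfolding y_def mult.assoc[symmetric]
      using rearr_nonneg[OF f p0, of "exp (X (m + 1))"] by (intro mult_right_mono) auto
  qed
  finally show ?thesis by (simp add: K_def)
qed

text \<open>Chebyshev bounds the rearrangement at \<open>t\<close> by a multiple of
  \<open>t powr (- 1/p)\<close>, and \<open>1 / q - 1 / p = - b\<close> is negative. This gives the
  limit that both recursion lemmas require.\<close>

lemma discrete_decay:
  fixes X :: "int \<Rightarrow> real"
  assumes f: "in_Lp f p" "0 < p" and q: "1 / q = 1 / p - b" and b: "0 < b"
    and sep: "\<And>m. X m + l \<le> X (m + 1)" and l: "0 < l"
  shows "(\<lambda>n. exp (X (int n) / q) * rearr f (exp (X (int n)))) \<longlonglongrightarrow> 0"
proof -
  define I where "I = (\<integral>x. \<bar>f x\<bar> powr p \<partial>lebesgue)"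
  have I0: "0 \<le> I" unfolding I_def by (intro integral_nonneg_AE) auto
  have bound: "exp (X (int n) / q) * rearr f (exp (X (int n))) \<le> I powr (1/p) * exp (- b * X 0) * exp (- b * l) ^ n" for n
  proof -
    let ?X = "X (int n)"
    have "exp (?X / q) * rearr f (exp ?X) \<le> exp (?X / q) * (I / exp ?X) powr (1/p)"
      using rearr_le[OF f, of "exp ?X"] by (intro mult_left_mono) (auto simp: I_def)
    also have "(I / exp ?X) powr (1/p) = I powr (1/p) * exp (- ?X / p)"
      using divide_exp_powr[OF I0, of ?X "1/p"] by simp
    also have "exp (?X / q) * (I powr (1/p) * exp (- ?X / p)) = I powr (1/p) * exp (- b * ?X)"
    proof -
      have "?X / q = ?X * (1 / q)" by simp
      then have "?X / q + - ?X / p = - b * ?X" unfolding q by (simp add: algebra_simps)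
      then have "exp (?X / q) * exp (- ?X / p) = exp (- b * ?X)" by (metis exp_add)
      then show ?thesis by (simp add: mult_ac)
    qed
    also have "\<dots> \<le> I powr (1/p) * (exp (- b * X 0) * exp (- b * l) ^ n)"
    proof (intro mult_left_mono)
      have "X 0 + real n * l \<le> ?X" using separated_growth[of X l 0 "int n", OF sep] by simp
      then have "b * (X 0 + real n * l) \<le> b * ?X" using b by simp
      then have "exp (- b * ?X) \<le> exp (- b * X 0 + real n * (- b * l))" by (simp add: algebra_simps)
      also have "\<dots> = exp (- b * X 0) * exp (- b * l) ^ n" by (simp only: exp_add exp_of_nat_mult)
      finally show "exp (- b * ?X) \<le> exp (- b * X 0) * exp (- b * l) ^ n" .
    qed simp
    finally show ?thesis by (simp add: mult_ac)
  qed
  have "(\<lambda>n. I powr (1/p) * exp (- b * X 0) * exp (- b * l) ^ n) \<longlonglongrightarrow> I powr (1/p) * exp (- b * X 0) * 0"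
    using b l by (intro tendsto_intros LIMSEQ_power_zero) auto
  then have lim: "(\<lambda>n. I powr (1/p) * exp (- b * X 0) * exp (- b * l) ^ n) \<longlonglongrightarrow> 0" by simp
  show ?thesis
  proof (rule tendsto_sandwich[OF _ _ tendsto_const lim])
    show "\<forall>\<^sub>F n in sequentially. 0 \<le> exp (X (int n) / q) * rearr f (exp (X (int n)))"
      using rearr_nonneg[OF f] by simp
    show "\<forall>\<^sub>F n in sequentially. exp (X (int n) / q) * rearr f (exp (X (int n)))
        \<le> I powr (1/p) * exp (- b * X 0) * exp (- b * l) ^ n"
      using bound by (rule always_eventually[OF allI])
  qed
qed

text \<open>Positive upper bounds \<open>N j\<close> replace the seminorms, since the argument
  divides by them. Here \<open>b\<close> is the number \<beta>/n of the theorem, and the exponents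
  \<open>b / \<beta> j\<close> sum to 1.\<close>

lemma lorentz_besov_bound:
  fixes p b q :: real and \<beta> :: "'n::finite \<Rightarrow> real" and \<theta> :: "'n \<Rightarrow> ereal" and th :: ereal
  assumes p: "1 \<le> p" and \<beta>: "\<And>j. 0 < \<beta> j" and b: "b = 1 / (\<Sum>j\<in>UNIV. 1 / \<beta> j)"
    and q: "0 < q" "1 / q = 1 / p - b" and \<theta>: "\<And>j. 0 < \<theta> j"
    and th: "(th = \<infinity> \<and> (\<forall>j. \<theta> j = \<infinity>)) \<or>
      (\<exists>r\<ge>1. th = ereal r \<and> (\<Sum>j\<in>{j. \<theta> j \<noteq> \<infinity>}. b / \<beta> j / real_of_ereal (\<theta> j)) = 1 / r)"
  shows "\<exists>c>0. \<forall>(f::real^'n \<Rightarrow> real) N. in_Lp f p \<longrightarrow>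
     (\<forall>j. 0 < N j \<and> besov_seminorm f (\<beta> j) p (\<theta> j) j \<le> ennreal (N j)) \<longrightarrow>
     lorentz_norm f q th \<le> ennreal (c * (\<Prod>j\<in>UNIV. N j powr (b / \<beta> j)))"
proof -
  have p0: "0 < p" using p by simp
  have s0: "0 < (\<Sum>j\<in>UNIV. 1 / \<beta> j)" using \<beta> by (intro sum_pos) auto
  then have b0: "0 < b" by (simp add: b)
  have sinv: "(\<Sum>j\<in>UNIV. 1 / \<beta> j) = 1 / b" using s0 by (simp add: b)
  have \<sigma>0: "0 < b / \<beta> j" for j using b0 \<beta>[of j] by simp
  have \<sigma>1: "(\<Sum>j\<in>UNIV. b / \<beta> j) = 1"
  proof -
    have "(\<Sum>j\<in>UNIV. b / \<beta> j) = b * (\<Sum>j\<in>UNIV. 1 / \<beta> j)" by (simp add: sum_distrib_left)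
    then show ?thesis using b0 by (simp add: sinv)
  qed
  define Reg where "Reg = (\<lambda>j C D (f::real^'n \<Rightarrow> real) N (x::int \<Rightarrow> real).
      (\<forall>m::int. x m + 2 * ln 2 / (3 * \<beta> j) \<le> x (m + 1) \<and> x (m + 1) \<le> x m + 2 * ln 2 / \<beta> j
        \<and> part_modulus f j (exp (x m)) p \<le> C * 2 powr m)
      \<and> weighted_bounded (\<theta> j) D (\<lambda>m. 2 powr m * exp (- \<beta> j * x m) / N))"
  \<comment> \<open>Constants that serve every \<open>f\<close> and \<open>N\<close> in direction
    \<open>j\<close>; they are chosen before any function is introduced.\<close>
  define Adm where "Adm = (\<lambda>j C D. 0 < C \<and> 0 < D \<and> (\<forall>f N. in_Lp f p \<longrightarrow> 0 < N \<longrightarrow>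
      besov_seminorm f (\<beta> j) p (\<theta> j) j \<le> ennreal N \<longrightarrow> (\<exists>x. Reg j C D f N x)))"
  have "\<exists>C D. Adm j C D" for j
  proof -
    obtain C D where CD: "0 < C" "0 < D"
      "\<And>(f::real^'n \<Rightarrow> real) p k N. in_Lp f p \<Longrightarrow> 0 < p \<Longrightarrow> 0 < N \<Longrightarrow> besov_seminorm f (\<beta> j) p (\<theta> j) k \<le> ennreal N \<Longrightarrow>
        \<exists>x::int \<Rightarrow> real. (\<forall>m. x m + 2 * ln 2 / (3 * \<beta> j) \<le> x (m + 1) \<and> x (m + 1) \<le> x m + 2 * ln 2 / \<beta> j
        \<and> part_modulus f k (exp (x m)) p \<le> C * 2 powr m)
      \<and> weighted_bounded (\<theta> j) D (\<lambda>m. 2 powr m * exp (- \<beta> j * x m) / N)"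
      by (rule besov_regular_sequence[OF \<beta>[of j] \<theta>[of j]]) (rule that)
    show ?thesis
      unfolding Adm_def Reg_def
      by (intro exI[of _ C] exI[of _ D] conjI CD(1,2) allI impI) (rule CD(3)[OF _ p0])
  qed
  then obtain Cj D where Adm: "\<And>j. Adm j (Cj j) (D j)" by metis
  have Cj0: "0 < Cj j" and D0: "0 < D j" for j using Adm[of j] by (auto simp: Adm_def)
  have Reg: "\<exists>x. Reg j (Cj j) (D j) f N x"
    if "in_Lp f p" "0 < N" "besov_seminorm f (\<beta> j) p (\<theta> j) j \<le> ennreal N" for j f N
    using Adm[of j] that by (simp add: Adm_def)
  define C where "C = (\<Sum>j\<in>UNIV. Cj j)"
  have CjC: "Cj j \<le> C" for j unfolding C_def using Cj0 by (intro member_le_sum) (auto intro: less_imp_le)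
  have C0: "0 < C" using Cj0 CjC less_le_trans by blast
  \<comment> \<open>\<open>l\<close> and \<open>L\<close> are the sums over \<open>j\<close> of the
    smallest and largest spacings of the \<open>x j\<close>, as the reciprocals of the
    \<open>\<beta> j\<close> add up to \<open>1 / b\<close>.\<close>
  define l where "l = 2 * ln 2 / (3 * b)"
  define L where "L = 2 * ln 2 / b"
  have l0: "0 < l" and L0: "0 < L" using b0 by (auto simp: l_def L_def)
  define K where "K = (2 * (4 powr p) ^ CARD('n)) powr (1/p) * 2 * C"
  have K0: "0 < K" using C0 by (simp add: K_def)
  define r where "r = exp (- l / q)"
  have r: "0 \<le> r" "r < 1" using l0 q by (auto simp: r_def)
  define J where "J = {j. \<theta> j \<noteq> \<infinity>}"
  define DD where "DD = (\<Sum>j\<in>J. D j)"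
  \<comment> \<open>Everything that the finite and the infinite case of \<open>th\<close> require of
    the sequences, so that the construction is carried out only once.\<close>
  define Good where "Good = (\<lambda>(f::real^'n \<Rightarrow> real) N (X::int \<Rightarrow> real) Z.
      (\<forall>m. X m + l \<le> X (m + 1)) \<and> (\<forall>m::int. X (m + 1) \<le> X m + L) \<and> (\<forall>m::int. (0::real) \<le> Z m) \<and>
      (\<forall>m. exp (X m / q) * rearr f (exp (X m)) \<le> r * (exp (X (m + 1) / q) * rearr f (exp (X (m + 1))))
         + K * ((\<Prod>j\<in>UNIV. N j powr (b / \<beta> j)) * Z m)) \<and>
      ((\<forall>j. \<theta> j = \<infinity>) \<longrightarrow> (\<forall>m. Z m \<le> 1)) \<and>
      (\<forall>\<rho> S. 0 < \<rho> \<longrightarrow> (\<Sum>j\<in>J. b / \<beta> j / real_of_ereal (\<theta> j)) = 1 / \<rho> \<longrightarrow> finite S \<longrightarrow> (\<Sum>m\<in>S. Z m powr \<rho>) \<le> DD))"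
  have main: "\<exists>X Z. Good f N X Z"
    if f: "in_Lp f p" and N: "\<And>j. 0 < N j" and le: "\<And>j. besov_seminorm f (\<beta> j) p (\<theta> j) j \<le> ennreal (N j)"
    for f :: "real^'n \<Rightarrow> real" and N
  proof -
    have "\<exists>x. Reg j (Cj j) (D j) f (N j) x" for j by (rule Reg[OF f N le])
    then obtain x where x: "\<And>j. Reg j (Cj j) (D j) f (N j) (x j)" by metis
    have x1: "x j m + 2 * ln 2 / (3 * \<beta> j) \<le> x j (m + 1)" and x2: "x j (m + 1) \<le> x j m + 2 * ln 2 / \<beta> j"
        and x3: "part_modulus f j (exp (x j m)) p \<le> Cj j * 2 powr m"
        and x4: "weighted_bounded (\<theta> j) (D j) (\<lambda>m. 2 powr m * exp (- \<beta> j * x j m) / N j)" for j m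
      using x[of j] by (auto simp: Reg_def)
    define X where "X m = (\<Sum>j\<in>UNIV. x j m)" for m
    define z where "z j m = 2 powr m * exp (- \<beta> j * x j m) / N j" for j and m :: int
    define Z where "Z m = (\<Prod>j\<in>UNIV. z j m powr (b / \<beta> j))" for m
    have z0: "0 < z j m" for j m using N[of j] by (simp add: z_def)
    have Z0: "0 \<le> Z m" for m unfolding Z_def by (intro prod_nonneg) auto
    have sep: "X m + l \<le> X (m + 1)" for m
    proof -
      have "X m + l = (\<Sum>j\<in>UNIV. x j m + 2 * ln 2 / (3 * \<beta> j))"
      proof -
        have "(\<Sum>j\<in>UNIV. 2 * ln 2 / (3 * \<beta> j)) = 2 * ln 2 / 3 * (\<Sum>j\<in>UNIV. 1 / \<beta> j)"
          by (simp add: sum_distrib_left)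
        then show ?thesis by (simp add: X_def sum.distrib sinv l_def)
      qed
      also have "\<dots> \<le> X (m + 1)" unfolding X_def by (intro sum_mono x1)
      finally show ?thesis .
    qed
    have upp: "X (m + 1) \<le> X m + L" for m
    proof -
      have "X (m + 1) \<le> (\<Sum>j\<in>UNIV. x j m + 2 * ln 2 / \<beta> j)" unfolding X_def by (intro sum_mono x2)
      also have "\<dots> = X m + L"
      proof -
        have "(\<Sum>j\<in>UNIV. 2 * ln 2 / \<beta> j) = 2 * ln 2 * (\<Sum>j\<in>UNIV. 1 / \<beta> j)" by (simp add: sum_distrib_left)
        then show ?thesis by (simp add: X_def sum.distrib sinv L_def)
      qed
      finally show ?thesis .
    qed
    \<comment> \<open>The exponents \<open>b / \<beta> j\<close> sum to 1, so the powers of 2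
      recombine to \<open>2 powr m\<close>; and \<open>\<beta> j * (b / \<beta> j) = b\<close>, so
      the points \<open>x j m\<close> add up to \<open>X m\<close>.\<close>
    have eq: "2 powr m * exp (- b * X m) = (\<Prod>j\<in>UNIV. N j powr (b / \<beta> j)) * Z m" for m :: int
    proof -
      have "(\<Prod>j\<in>UNIV. N j powr (b / \<beta> j)) * Z m = (\<Prod>j\<in>UNIV. N j powr (b / \<beta> j) * z j m powr (b / \<beta> j))"
        by (simp add: Z_def prod.distrib)
      also have "\<dots> = (\<Prod>j\<in>UNIV. exp (of_int m * ln 2 * (b / \<beta> j) - b * x j m))"
      proof (intro prod.cong refl)
        fix j
        have "N j powr (b / \<beta> j) * z j m powr (b / \<beta> j) = (N j * z j m) powr (b / \<beta> j)"
          using N[of j] z0[of j m] by (simp add: powr_mult)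
        also have "N j * z j m = exp (of_int m * ln 2 - \<beta> j * x j m)"
          using N[of j] by (simp add: z_def powr_def exp_diff exp_minus divide_inverse)
        also have "\<dots> powr (b / \<beta> j) = exp (of_int m * ln 2 * (b / \<beta> j) - b * x j m)"
          using \<beta>[of j] by (simp add: powr_def field_simps)
        finally show "N j powr (b / \<beta> j) * z j m powr (b / \<beta> j) = exp (of_int m * ln 2 * (b / \<beta> j) - b * x j m)" .
      qed
      also have "\<dots> = exp (\<Sum>j\<in>UNIV. of_int m * ln 2 * (b / \<beta> j) - b * x j m)" by (simp add: exp_sum)
      also have "(\<Sum>j\<in>UNIV. of_int m * ln 2 * (b / \<beta> j) - b * x j m) = of_int m * ln 2 - b * X m"
        unfolding sum_subtractf sum_distrib_left[symmetric] \<sigma>1 X_def by simp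
      also have "exp \<dots> = 2 powr m * exp (- b * X m)" by (simp add: powr_def exp_diff exp_minus divide_inverse)
      finally show ?thesis by simp
    qed
    have rec: "exp (X m / q) * rearr f (exp (X m)) \<le> r * (exp (X (m + 1) / q) * rearr f (exp (X (m + 1))))
         + K * ((\<Prod>j\<in>UNIV. N j powr (b / \<beta> j)) * Z m)" for m
    proof -
      have "part_modulus f j (exp (x j m)) p \<le> C * 2 powr m" for j m
        using x3[of j m] CjC[of j] by (rule order_trans[OF _ mult_right_mono]) auto
      from discrete_recursion[where x=x, OF f p q sep[unfolded X_def] this]
      show ?thesis unfolding eq[symmetric] by (simp add: X_def r_def K_def)
    qed
    have Zinf: "Z m \<le> 1" if "\<forall>j. \<theta> j = \<infinity>" for m
      unfolding Z_def
    proof (rule prod_le_1)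
      fix j
      have "z j m \<le> 1" using x4[of j] that by (simp add: weighted_bounded_def z_def)
      then show "0 \<le> z j m powr (b / \<beta> j) \<and> z j m powr (b / \<beta> j) \<le> 1"
        using \<sigma>0[of j] z0[of j m] by (simp add: powr_le1)
    qed
    have Zsum: "(\<Sum>m\<in>S. Z m powr \<rho>) \<le> DD"
      if \<rho>: "0 < \<rho>" "(\<Sum>j\<in>J. b / \<beta> j / real_of_ereal (\<theta> j)) = 1 / \<rho>" and S: "finite S" for \<rho> S
    proof -
      \<comment> \<open>The weights that rewrite \<open>Z m powr \<rho>\<close> through the summable
        powers of the \<open>z j m\<close>. They sum to 1 exactly because of the relation defining
        \<open>\<rho>\<close>.\<close>
      define \<tau> where "\<tau> j = \<rho> * (b / \<beta> j / real_of_ereal (\<theta> j))" for j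
      have rj: "0 < real_of_ereal (\<theta> j)" if "j \<in> J" for j
        using \<theta>[of j] that by (cases "\<theta> j") (auto simp: J_def)
      have \<tau>0: "0 \<le> \<tau> j" if "j \<in> J" for j
        unfolding \<tau>_def using rj[OF that] b0 \<beta>[of j] \<rho>(1) by (intro mult_nonneg_nonneg divide_nonneg_nonneg) auto
      have \<tau>1: "(\<Sum>j\<in>J. \<tau> j) = 1" unfolding \<tau>_def sum_distrib_left[symmetric] \<rho>(2) using \<rho>(1) by simp
      have "Z m powr \<rho> \<le> (\<Sum>j\<in>J. \<tau> j * z j m powr real_of_ereal (\<theta> j))" for m
      proof -
        \<comment> \<open>The directions with infinite \<open>\<theta> j\<close> contribute factors
          at most 1 and are discarded before AM-GM.\<close>
        have "Z m = (\<Prod>j\<in>J. z j m powr (b / \<beta> j)) * (\<Prod>j\<in>-J. z j m powr (b / \<beta> j))"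
          unfolding Z_def by (subst prod.union_disjoint[symmetric]) (auto simp: Compl_partition)
        also have "\<dots> \<le> (\<Prod>j\<in>J. z j m powr (b / \<beta> j)) * 1"
        proof (intro mult_left_mono prod_le_1 prod_nonneg)
          fix j assume "j \<in> - J"
          then have "z j m \<le> 1" using x4[of j] by (simp add: weighted_bounded_def z_def J_def)
          then show "0 \<le> z j m powr (b / \<beta> j) \<and> z j m powr (b / \<beta> j) \<le> 1"
            using \<sigma>0[of j] z0[of j m] by (simp add: powr_le1)
        qed auto
        finally have "Z m powr \<rho> \<le> (\<Prod>j\<in>J. z j m powr (b / \<beta> j)) powr \<rho>"
          using Z0[of m] \<rho>(1) by (intro powr_mono2) auto
        also have "\<dots> = (\<Prod>j\<in>J. (z j m powr (b / \<beta> j)) powr \<rho>)"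
          by (simp add: prod_powr_distrib)
        also have "\<dots> = (\<Prod>j\<in>J. (z j m powr real_of_ereal (\<theta> j)) powr \<tau> j)"
        proof (intro prod.cong refl)
          fix j assume "j \<in> J"
          then have "b / \<beta> j * \<rho> = real_of_ereal (\<theta> j) * \<tau> j" using rj[of j] by (simp add: \<tau>_def)
          then show "(z j m powr (b / \<beta> j)) powr \<rho> = (z j m powr real_of_ereal (\<theta> j)) powr \<tau> j"
            by (simp only: powr_powr)
        qed
        also have "\<dots> \<le> (\<Sum>j\<in>J. \<tau> j * z j m powr real_of_ereal (\<theta> j))"
        proof (rule weighted_AM_GM)
          show "0 < z j m powr real_of_ereal (\<theta> j)" for j using z0[of j m] by simp
        qed (use \<tau>0 \<tau>1 in auto)
        finally show ?thesis .
      qed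
      then have "(\<Sum>m\<in>S. Z m powr \<rho>) \<le> (\<Sum>m\<in>S. \<Sum>j\<in>J. \<tau> j * z j m powr real_of_ereal (\<theta> j))"
        by (intro sum_mono)
      also have "\<dots> = (\<Sum>j\<in>J. \<tau> j * (\<Sum>m\<in>S. z j m powr real_of_ereal (\<theta> j)))"
        by (subst sum.swap) (simp add: sum_distrib_left)
      also have "\<dots> \<le> (\<Sum>j\<in>J. 1 * D j)"
      proof (intro sum_mono mult_mono)
        fix j assume j: "j \<in> J"
        show "\<tau> j \<le> 1" unfolding \<tau>1[symmetric] using j \<tau>0 by (intro member_le_sum) auto
        show "(\<Sum>m\<in>S. z j m powr real_of_ereal (\<theta> j)) \<le> D j"
          using x4[of j] j S by (simp add: weighted_bounded_def z_def J_def)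
      qed (auto intro: sum_nonneg)
      finally show ?thesis by (simp add: DD_def)
    qed
    have "Good f N X Z"
      unfolding Good_def by (intro conjI allI impI sep upp Z0 rec) (blast intro: Zinf Zsum)+
    then show ?thesis by blast
  qed
  show ?thesis
    using th
  proof (elim disjE conjE exE)
    assume thi: "th = \<infinity>" and all: "\<forall>j. \<theta> j = \<infinity>"
    show ?thesis
    proof (intro exI[of _ "exp (L / q) * (K / (1 - r))"] conjI allI impI)
      show "0 < exp (L / q) * (K / (1 - r))" using K0 r by simp
      fix f :: "real^'n \<Rightarrow> real" and N
      assume f: "in_Lp f p" and N: "\<forall>j. 0 < N j \<and> besov_seminorm f (\<beta> j) p (\<theta> j) j \<le> ennreal (N j)"
      define P where "P = (\<Prod>j\<in>UNIV. N j powr (b / \<beta> j))"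
      have P0: "0 \<le> P" unfolding P_def by (intro prod_nonneg) auto
      obtain X Z where "Good f N X Z" using main[OF f] N by blast
      then have X: "\<And>m. X m + l \<le> X (m + 1)" "\<And>m. X (m + 1) \<le> X m + L"
        and Z: "\<And>m. 0 \<le> Z m" "\<And>m. Z m \<le> 1"
        and rec: "\<And>m. exp (X m / q) * rearr f (exp (X m)) \<le> r * (exp (X (m + 1) / q) * rearr f (exp (X (m + 1)))) + K * (P * Z m)"
        using all unfolding Good_def P_def by blast+
      have "exp (X m / q) * rearr f (exp (X m)) \<le> K * P / (1 - r)" for m
      proof (rule recursive_sup_bound[where y="\<lambda>m. exp (X m / q) * rearr f (exp (X m))", OF r])
        show "0 \<le> exp (X m / q) * rearr f (exp (X m))" for m using rearr_nonneg[OF f p0] by simp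
        show "exp (X m / q) * rearr f (exp (X m)) \<le> r * (exp (X (m + 1) / q) * rearr f (exp (X (m + 1)))) + K * P" for m
        proof -
          have "K * (P * Z m) \<le> K * (P * 1)" using K0 P0 Z by (intro mult_left_mono) auto
          then show ?thesis using rec[of m] by simp
        qed
        show "(\<lambda>n. exp (X (int n) / q) * rearr f (exp (X (int n)))) \<longlonglongrightarrow> 0"
          by (rule discrete_decay[where X=X, OF f p0 q(2) b0 X(1) l0])
      qed
      from lorentz_norm_le_discrete_sup[where X=X, OF f p0 q(1) l0 X this]
      show "lorentz_norm f q th \<le> ennreal (exp (L / q) * (K / (1 - r)) * (\<Prod>j\<in>UNIV. N j powr (b / \<beta> j)))"
        by (simp add: thi P_def mult.assoc)
    qed
  next
    fix \<rho> assume \<rho>: "1 \<le> \<rho>" and thr: "th = ereal \<rho>"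
      and sum: "(\<Sum>j\<in>{j. \<theta> j \<noteq> \<infinity>}. b / \<beta> j / real_of_ereal (\<theta> j)) = 1 / \<rho>"
    have \<rho>0: "0 < \<rho>" using \<rho> by simp
    \<comment> \<open>An empty sum could not equal \<open>1 / \<rho>\<close>. Nonemptiness makes
      \<open>DD\<close>, and with it the constant, strictly positive.\<close>
    have "J \<noteq> {}" using sum \<rho> by (intro notI) (simp add: J_def)
    then have DD0: "0 < DD" unfolding DD_def using D0 by (intro sum_pos) auto
    define c where "c = exp (L / q) * (exp L - 1) powr (1/\<rho>) * (K / (1 - r) * DD powr (1/\<rho>))"
    show ?thesis
    proof (intro exI[of _ c] conjI allI impI)
      show "0 < c" using K0 r L0 DD0 by (simp add: c_def)
      fix f :: "real^'n \<Rightarrow> real" and N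
      assume f: "in_Lp f p" and N: "\<forall>j. 0 < N j \<and> besov_seminorm f (\<beta> j) p (\<theta> j) j \<le> ennreal (N j)"
      define P where "P = (\<Prod>j\<in>UNIV. N j powr (b / \<beta> j))"
      have P0: "0 \<le> P" unfolding P_def by (intro prod_nonneg) auto
      obtain X Z where "Good f N X Z" using main[OF f] N by blast
      then have X: "\<And>m. X m + l \<le> X (m + 1)" "\<And>m. X (m + 1) \<le> X m + L"
        and Z: "\<And>m. 0 \<le> Z m" and Zs: "\<And>S. finite S \<Longrightarrow> (\<Sum>m\<in>S. Z m powr \<rho>) \<le> DD"
        and rec: "\<And>m. exp (X m / q) * rearr f (exp (X m)) \<le> r * (exp (X (m + 1) / q) * rearr f (exp (X (m + 1)))) + K * (P * Z m)"
        using sum \<rho>0 unfolding Good_def P_def J_def by blast+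
      define Bd where "Bd = K / (1 - r) * DD powr (1/\<rho>) * P"
      have Bd0: "0 \<le> Bd" unfolding Bd_def using K0 r P0 by simp
      have "(\<Sum>m\<in>S. (exp (X m / q) * rearr f (exp (X m))) powr \<rho>) \<le> Bd powr \<rho>" if S: "finite S" for S
      proof -
        have "(\<Sum>m\<in>S. (exp (X m / q) * rearr f (exp (X m))) powr \<rho>) \<le> (K / (1 - r)) powr \<rho> * (P powr \<rho> * DD)"
        proof (rule recursive_sum_bound[where X="\<lambda>m. P * Z m" and y="\<lambda>m. exp (X m / q) * rearr f (exp (X m))", OF r \<rho> _ _ rec])
          show "0 \<le> exp (X m / q) * rearr f (exp (X m))" for m using rearr_nonneg[OF f p0] by simp
          show "0 \<le> P * Z m" for m using P0 Z by simp
          show "0 \<le> K" using K0 by simp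
          show "(\<lambda>n. exp (X (int n) / q) * rearr f (exp (X (int n)))) \<longlonglongrightarrow> 0"
            by (rule discrete_decay[where X=X, OF f p0 q(2) b0 X(1) l0])
          show "(\<Sum>m\<in>S. (P * Z m) powr \<rho>) \<le> P powr \<rho> * DD" if "finite S" for S
            using Zs[OF that] P0 Z by (simp add: powr_mult mult_left_mono flip: sum_distrib_left)
        qed fact
        also have "\<dots> = Bd powr \<rho>"
          using K0 r P0 DD0 \<rho> by (simp add: Bd_def powr_mult powr_divide powr_powr)
        finally show ?thesis .
      qed
      then have "lorentz_norm f q (ereal \<rho>) \<le> ennreal (exp (L / q) * (exp L - 1) powr (1/\<rho>) * Bd)"
        by (intro lorentz_norm_le_discrete_sum[where X=X, OF f p0 q(1) l0 \<rho>0 X _ Bd0]) auto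
      then show "lorentz_norm f q th \<le> ennreal (c * (\<Prod>j\<in>UNIV. N j powr (b / \<beta> j)))"
        by (simp add: thr c_def Bd_def P_def mult_ac)
    qed
  qed
qed

section \<open>Vanishing seminorms and the normalised constant\<close>

text \<open>Powers with positive exponent are continuous at 0, so a bound for strictly positive
  numbers passes to the limit where some of the \<open>s j\<close> vanish.\<close>

lemma ennreal_le_of_perturbed_prod:
  fixes s e :: "'n::finite \<Rightarrow> real"
  assumes e: "\<And>j. 0 < e j" and s: "\<And>j. 0 \<le> s j"
    and le: "\<And>\<eta>. 0 < \<eta> \<Longrightarrow> a \<le> ennreal (c * (\<Prod>j\<in>UNIV. (s j + \<eta>) powr e j))"
  shows "a \<le> ennreal (c * (\<Prod>j\<in>UNIV. s j powr e j))"
proof -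
  have "(\<lambda>n. c * (\<Prod>j\<in>UNIV. (s j + inverse (real (Suc n))) powr e j)) \<longlonglongrightarrow> c * (\<Prod>j\<in>UNIV. (s j + 0) powr e j)"
    using e s by (intro tendsto_intros tendsto_powr' LIMSEQ_inverse_real_of_nat disjI2 conjI always_eventually) auto
  then have "(\<lambda>n. ennreal (c * (\<Prod>j\<in>UNIV. (s j + inverse (real (Suc n))) powr e j)))
      \<longlonglongrightarrow> ennreal (c * (\<Prod>j\<in>UNIV. s j powr e j))"
    by (intro tendsto_ennrealI) simp
  then show ?thesis
    by (rule LIMSEQ_le_const) (use le in auto)
qed

theorem theorem4p1:
  fixes p :: real and \<beta> :: "'n::finite \<Rightarrow> real" and \<theta> :: "'n \<Rightarrow> ereal"
  defines "bt \<equiv> real CARD('n) / (\<Sum>j\<in>UNIV. 1 / \<beta> j)"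
  defines "th \<equiv> ereal (real CARD('n) / bt) * inverse (\<Sum>j\<in>UNIV. ereal (1 / \<beta> j) * inverse (\<theta> j))"
  defines "q \<equiv> real CARD('n) * p / (real CARD('n) - bt * p)"
  assumes "CARD('n) \<ge> 2"
    and "1 \<le> p"
    and "\<And>j. ereal p \<le> \<theta> j"
    and "\<And>j. 0 < \<beta> j \<and> \<beta> j < 1"
    and "p < real CARD('n) / bt"
  shows "\<exists>c>0. \<forall>f :: real^'n \<Rightarrow> real. (\<forall>j. in_Besov f (\<beta> j) p (\<theta> j) j) \<longrightarrow>
           lorentz_norm f q th \<le>
             ennreal (c * (\<Prod>j\<in>UNIV. ((1 - \<beta> j) powr real_of_ereal (inverse (\<theta> j))
                  * enn2real (besov_seminorm f (\<beta> j) p (\<theta> j) j)) powr (bt / (real CARD('n) * \<beta> j))))"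
proof -
  note p = \<open>1 \<le> p\<close> and \<theta>p = \<open>\<And>j. ereal p \<le> \<theta> j\<close>
  have \<beta>: "0 < \<beta> j" "\<beta> j < 1" for j using assms(7) by auto
  define n where "n = real CARD('n)"
  have n: "0 < n" by (simp add: n_def)
  define b where "b = 1 / (\<Sum>j\<in>UNIV. 1 / \<beta> j)"
  have s0: "0 < (\<Sum>j\<in>UNIV. 1 / \<beta> j)" using \<beta> by (intro sum_pos) auto
  have b0: "0 < b" using s0 by (simp add: b_def)
  have bt: "bt = n * b" by (simp add: bt_def b_def n_def)
  have \<sigma>: "bt / (real CARD('n) * \<beta> j) = b / \<beta> j" for j using n by (simp add: bt flip: n_def)
  have \<sigma>1: "(\<Sum>j\<in>UNIV. b / \<beta> j) = 1"
  proof -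
    have "(\<Sum>j\<in>UNIV. b / \<beta> j) = b * (\<Sum>j\<in>UNIV. 1 / \<beta> j)" by (simp add: sum_distrib_left)
    then show ?thesis using s0 by (simp add: b_def)
  qed
  have pb: "p * b < 1" using assms(8) n b0 by (simp add: bt field_simps flip: n_def)
  have q': "q = p / (1 - p * b)"
  proof -
    have "n - bt * p = n * (1 - p * b)" by (simp add: bt algebra_simps)
    then show ?thesis unfolding q_def n_def[symmetric] using n by simp
  qed
  have q: "0 < q" "1 / q = 1 / p - b" using p pb by (auto simp: q' field_simps)
  have \<theta>0: "0 < \<theta> j" for j
    using \<theta>p[of j] p by (cases "\<theta> j") auto
  define J where "J = {j. \<theta> j \<noteq> \<infinity>}"
  define R where "R j = real_of_ereal (\<theta> j)" for j
  have R: "\<theta> j = ereal (R j)" "1 \<le> R j" if "j \<in> J" for j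
    using \<theta>p[of j] p that by (cases "\<theta> j"; simp add: J_def R_def)+
  define s where "s = (\<Sum>j\<in>J. 1 / \<beta> j / R j)"
  \<comment> \<open>Directions with infinite \<open>\<theta> j\<close> contribute 0, which reduces
    the extended-real sum to a real one.\<close>
  have S: "(\<Sum>j\<in>UNIV. ereal (1 / \<beta> j) * inverse (\<theta> j)) = ereal s"
  proof -
    have "(\<Sum>j\<in>UNIV. ereal (1 / \<beta> j) * inverse (\<theta> j)) = (\<Sum>j\<in>J. ereal (1 / \<beta> j) * inverse (\<theta> j))"
      by (rule sum.mono_neutral_right) (auto simp: J_def)
    also have "\<dots> = (\<Sum>j\<in>J. ereal (1 / \<beta> j / R j))"
    proof (rule sum.cong[OF refl])
      fix j assume "j \<in> J"
      then show "ereal (1 / \<beta> j) * inverse (\<theta> j) = ereal (1 / \<beta> j / R j)"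
        using R[of j] by (simp add: divide_inverse)
    qed
    finally show ?thesis by (simp add: s_def)
  qed
  have thS: "th = ereal (1 / b) * inverse (ereal s)"
    unfolding th_def S n_def[symmetric] using n by (simp add: bt)
  \<comment> \<open>If \<open>J\<close> is empty, \<open>th\<close> is a positive number times the
    inverse of 0, which is \<infinity>. Otherwise it equals \<open>1 / (b * s)\<close>, and
    \<open>b * s\<close> is at most 1 because each \<open>R j\<close> is at least 1 and the weights
    \<open>b / \<beta> j\<close> sum to 1.\<close>
  have th: "(th = \<infinity> \<and> (\<forall>j. \<theta> j = \<infinity>)) \<or>
      (\<exists>r\<ge>1. th = ereal r \<and> (\<Sum>j\<in>{j. \<theta> j \<noteq> \<infinity>}. b / \<beta> j / real_of_ereal (\<theta> j)) = 1 / r)"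
  proof (cases "J = {}")
    case True
    then show ?thesis using b0 by (auto simp: thS s_def J_def)
  next
    case False
    have s: "0 < s" unfolding s_def
    proof (rule sum_pos)
      fix j assume "j \<in> J"
      then show "0 < 1 / \<beta> j / R j" using R(2)[of j] \<beta>(1)[of j] by simp
    qed (use False in auto)
    have bs: "(\<Sum>j\<in>J. b / \<beta> j / R j) = b * s" by (simp add: s_def sum_distrib_left)
    have "(\<Sum>j\<in>J. b / \<beta> j / R j) \<le> (\<Sum>j\<in>J. b / \<beta> j)"
    proof (rule sum_mono)
      fix j assume "j \<in> J"
      then show "b / \<beta> j / R j \<le> b / \<beta> j"
        using R(2)[of j] b0 \<beta>(1)[of j] divide_left_mono[of 1 "R j" "b / \<beta> j"] by simp
    qed
    also have "\<dots> \<le> (\<Sum>j\<in>UNIV. b / \<beta> j)" using b0 \<beta> by (intro sum_mono2) (auto intro: less_imp_le)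
    finally have "b * s \<le> 1" unfolding bs \<sigma>1 .
    moreover have "0 < b * s" using b0 s by simp
    ultimately have "1 \<le> 1 / (b * s)" by simp
    moreover have "th = ereal (1 / (b * s))" using s b0 by (simp add: thS divide_inverse)
    ultimately show ?thesis
      using bs by (intro disjI2 exI[of _ "1 / (b * s)"]) (simp add: J_def R_def)
  qed
  obtain c where c: "0 < c" and bound: "\<And>(f::real^'n \<Rightarrow> real) N. in_Lp f p \<Longrightarrow>
     (\<And>j. 0 < N j \<and> besov_seminorm f (\<beta> j) p (\<theta> j) j \<le> ennreal (N j)) \<Longrightarrow>
     lorentz_norm f q th \<le> ennreal (c * (\<Prod>j\<in>UNIV. N j powr (b / \<beta> j)))"
    using lorentz_besov_bound[OF p \<beta>(1) b_def q \<theta>0 th] by blast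
  \<comment> \<open>The product of all factors in \<open>1 - \<beta> j\<close>. It is positive and
    independent of \<open>f\<close>, so dividing \<open>c\<close> by it introduces these factors
    into the estimate.\<close>
  define \<kappa> where "\<kappa> = (\<Prod>j\<in>UNIV. ((1 - \<beta> j) powr real_of_ereal (inverse (\<theta> j))) powr (b / \<beta> j))"
  have \<kappa>: "0 < \<kappa>"
  proof -
    have "1 - \<beta> j \<noteq> 0" for j using \<beta>(2)[of j] by simp
    then show ?thesis unfolding \<kappa>_def by (intro prod_pos) simp
  qed
  show ?thesis
  proof (intro exI[of _ "c / \<kappa>"] conjI allI impI)
    show "0 < c / \<kappa>" using c \<kappa> by simp
    fix f :: "real^'n \<Rightarrow> real"
    assume f: "\<forall>j. in_Besov f (\<beta> j) p (\<theta> j) j"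
    define B where "B j = enn2real (besov_seminorm f (\<beta> j) p (\<theta> j) j)" for j
    have BB: "besov_seminorm f (\<beta> j) p (\<theta> j) j = ennreal (B j)" for j
      using f by (auto simp: in_Besov_def B_def less_top)
    have "lorentz_norm f q th \<le> ennreal (c * (\<Prod>j\<in>UNIV. B j powr (b / \<beta> j)))"
    \<comment> \<open>Some \<open>B j\<close> may be 0, so \<open>bound\<close> is applied with the
      positive numbers \<open>B j + \<eta>\<close>.\<close>
    proof (rule ennreal_le_of_perturbed_prod)
      show "0 < b / \<beta> j" "0 \<le> B j" for j using b0 \<beta>(1)[of j] by (auto simp: B_def)
      then show "lorentz_norm f q th \<le> ennreal (c * (\<Prod>j\<in>UNIV. (B j + \<eta>) powr (b / \<beta> j)))" if "0 < \<eta>" for \<eta>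
        using f that by (intro bound) (auto simp: BB in_Besov_def intro!: ennreal_leI add_nonneg_pos)
    qed
    also have "c * (\<Prod>j\<in>UNIV. B j powr (b / \<beta> j))
      = c / \<kappa> * (\<Prod>j\<in>UNIV. ((1 - \<beta> j) powr real_of_ereal (inverse (\<theta> j)) * B j) powr (b / \<beta> j))"
    proof -
      have "(\<Prod>j\<in>UNIV. ((1 - \<beta> j) powr real_of_ereal (inverse (\<theta> j)) * B j) powr (b / \<beta> j))
          = \<kappa> * (\<Prod>j\<in>UNIV. B j powr (b / \<beta> j))"
        unfolding \<kappa>_def prod.distrib[symmetric] by (intro prod.cong refl) (simp add: powr_mult B_def)
      then show ?thesis using \<kappa> by simp
    qed
    finally show "lorentz_norm f q th \<le> ennreal (c / \<kappa> * (\<Prod>j\<in>UNIV.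
        ((1 - \<beta> j) powr real_of_ereal (inverse (\<theta> j))
          * enn2real (besov_seminorm f (\<beta> j) p (\<theta> j) j)) powr (bt / (real CARD('n) * \<beta> j))))"
      unfolding \<sigma> B_def .
  qed
qed

end
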